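(* Let $(a_n)_{n\ge0}$ be integers with $0\le a_n\le a_{n+1}\le a_n+1$ for all $n$ and $a_n\to\infty$. Let $(\boldsymbol Z_n:n\in\mathbb N)$ be the aging branching process with immigration, with maximal ages $(a_n)$, reproduction law $R$ of mean $m=\mathbf E(R)>0$ and immigration $(I_n)$, as defined in the context, and assume that $$\mathbf E(R^2)<\infty,\qquad \limsup_{n\to\infty}\frac{\log(\mathbf E(I_n))}{n}<\log(1+m),\qquad \mathbf P(I_n\ge x)\ge\mathbf P(I\ge x)\ \text{ for all } x\ge0 \text{ and all } n,$$ where $I$ is a non-negative random variable with $\mathbf P(I>0)>0$. Let $m_n$ be the mean size in generation $n$ of the process without immigration started from one newborn. Then: (i) The process $(\boldsymbol Z_n/m_n:n\in\mathbb N)$ converges a.s. to a finite positive random variable. (ii) For each integer $a\ge0$, $(\boldsymbol Z_n(a)/\boldsymbol Z_n:n\in\mathbb N)$ converges a.s. to $m/(m+1)^{a+1}$.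
   Context: $\mathbb N=\{0,1,2,\dots\}$. $R$ is a random variable with values in $\mathbb N$. Process with immigration: $\boldsymbol Z_n(a)$ is the number of individuals of age $a$ in generation $n$. It is initialized with a bounded random vector $(\boldsymbol Z_0(a):a\in\mathbb N)$ of non-negative integers, independent of everything below, with $\boldsymbol Z_0(a)=0$ if $a>a_0$ (and $\boldsymbol Z_0=\sum_{a=0}^{a_0}\boldsymbol Z_0(a)$), and for $n\ge1$, $\boldsymbol Z_n(a)=\boldsymbol Z_{n-1}(a-1)\mathbf 1_{\{a\le a_n\}}$ for $a\ge1$; $\boldsymbol Z_n(0)=\sum_{j=1}^{\boldsymbol Z_{n-1}}R_{j,n}+I_n$; $\boldsymbol Z_n=\sum_{a=0}^{a_n}\boldsymbol Z_n(a)$, where $(R_{j,n})_{j,n}$ are i.i.d. copies of $R$ and $(I_n)_n$ are independent $\mathbb N$-valued random variables, independent of $(R_{j,n})_{j,n}$. Process without immigration: $Z_0(0)=1$, $Z_0(a)=0$ for $a\ge1$, and for $n\ge1$, $Z_n(a)=Z_{n-1}(a-1)\mathbf 1_{\{a\le a_n\}}$ for $a\ge1$, $Z_n(0)=\sum_{j=1}^{Z_{n-1}}R_{j,n}$, $Z_n=\sum_{a=0}^{a_n}Z_n(a)$. Its mean is $m_n=\mathbf E(Z_n)$. *)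

theory Defs
  imports "HOL-Probability.Probability"
begin

(* The natural logarithm on [0, \<infinity>], as an expectation of a nonnegative random variable
   may be infinite. *)
definition ln_ennreal :: "ennreal \<Rightarrow> ereal" where
  "ln_ennreal x = (if x = 0 then -\<infinity> else if x = \<infinity> then \<infinity> else ereal (ln (enn2real x)))"

(* One realization of the process: amax n is the maximal age in generation n, z0 a is the initial
   number of individuals of age a, r j n is the number of children born in generation n to the
   j-th individual of generation n - 1, and imm n is the number of immigrants in generation n.
   Only the values r j n and imm n with j \<ge> 1 and n \<ge> 1 are used. *)
primrec aging_bp ::
  "(nat \<Rightarrow> nat) \<Rightarrow> (nat \<Rightarrow> nat) \<Rightarrow> (nat \<Rightarrow> nat \<Rightarrow> nat) \<Rightarrow> (nat \<Rightarrow> nat) \<Rightarrow> nat \<Rightarrow> nat \<Rightarrow> nat"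
where
  "aging_bp amax z0 r imm 0 = z0"
| "aging_bp amax z0 r imm (Suc n) =
     (\<lambda>a. if a = 0
          then (\<Sum>j = 1..(\<Sum>b\<le>amax n. aging_bp amax z0 r imm n b). r j (Suc n)) + imm (Suc n)
          else if a \<le> amax (Suc n) then aging_bp amax z0 r imm n (a - 1) else 0)"

definition aging_bp_size ::
  "(nat \<Rightarrow> nat) \<Rightarrow> (nat \<Rightarrow> nat) \<Rightarrow> (nat \<Rightarrow> nat \<Rightarrow> nat) \<Rightarrow> (nat \<Rightarrow> nat) \<Rightarrow> nat \<Rightarrow> nat"
where
  "aging_bp_size amax z0 r imm n = (\<Sum>a\<le>amax n. aging_bp amax z0 r imm n a)"

(* The mean size in generation n of the process without immigration (imm = 0) that starts from
   a single individual, of age 0. *)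
definition mean_size ::
  "'a measure \<Rightarrow> (nat \<Rightarrow> nat) \<Rightarrow> (nat \<Rightarrow> nat \<Rightarrow> 'a \<Rightarrow> nat) \<Rightarrow> nat \<Rightarrow> real"
where
  "mean_size M amax R n =
     (\<integral>\<omega>. real (aging_bp_size amax (\<lambda>a. if a = 0 then 1 else 0) (\<lambda>j k. R j k \<omega>) (\<lambda>_. 0) n) \<partial>M)"

datatype source = Initial | Offspring nat nat | Immigration nat

(* Mutual independence of the random vector (Z0 a : a), of all R j n and of all I n (j, n \<ge> 1),
   where the ages of the initial individuals need not be independent of each other.
   It is stated through generated sigma-algebras because indep_vars requires
   all variables to take values in the same type. *)
definition (in prob_space) indep_sources ::
  "(nat \<Rightarrow> 'a \<Rightarrow> nat) \<Rightarrow> (nat \<Rightarrow> nat \<Rightarrow> 'a \<Rightarrow> nat) \<Rightarrow> (nat \<Rightarrow> 'a \<Rightarrow> nat) \<Rightarrow> bool"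
where
  "indep_sources Z0 R I \<longleftrightarrow>
     indep_sets
       (\<lambda>s. case s of
              Initial \<Rightarrow> sets (vimage_algebra (space M) (\<lambda>\<omega> a. Z0 a \<omega>)
                                (\<Pi>\<^sub>M a\<in>UNIV. count_space UNIV))
            | Offspring j n \<Rightarrow> sets (vimage_algebra (space M) (R j n) (count_space UNIV))
            | Immigration n \<Rightarrow> sets (vimage_algebra (space M) (I n) (count_space UNIV)))
       ({Initial} \<union> {Offspring j n | j n. j \<ge> 1 \<and> n \<ge> 1} \<union> {Immigration n | n. n \<ge> 1})"

end

theory Submission
  imports Defs
begin

text \<open>
  Write \<open>g = 1 + m\<close>. In each generation the population reproduces with mean
  factor \<open>m\<close>, and the only losses are the individuals that reach the maximal age. They were born
  \<open>a n\<close> generations ago, when the population was exponentially smaller, so that the mean sizes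
  satisfy \<open>m\<^sub>n\<^sub>+\<^sub>1 / m\<^sub>n \<longlonglongrightarrow> g\<close>. They may nevertheless be of smaller order than \<open>g ^ n\<close>, since the
  fractions lost need not be summable; this is why the normalisation is by \<open>m\<^sub>n\<close>.

  Along a fixed realization the process solves the linear recursion of the means with an additive
  perturbation: in generation \<open>n\<close> there are \<open>m * Z (n - 1) + e n\<close> newborns, where \<open>e n\<close> consists of
  the immigrants and of the deviation of the litters from their mean. The deviation has
  conditional variance proportional to \<open>Z (n - 1)\<close>, hence it is of order \<open>g ^ (n / 2)\<close>, and the
  immigrants are of order \<open>r ^ n\<close> with \<open>r < g\<close>. Therefore \<open>\<bar>e n\<bar> / \<rho> ^ n\<close> is almost surely summable
  for some \<open>\<rho> < g\<close> (\<open>AE_perturbation_summable\<close>), whereas \<open>m\<^sub>n\<close> grows faster than \<open>\<rho> ^ n\<close>. No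
  martingale is involved; all series converge absolutely, and the rest of the convergence proof is
  deterministic.

  The deterministic part compares a perturbed population with the mean one. The increments of
  their ratio obey a renewal inequality: each is at most a weighted sum of the
  earlier increments plus perturbations. The weights come from deaths and decay geometrically
  in the delay, because dying at a delay \<open>d\<close> requires a maximal age of order \<open>d\<close>
  (\<open>increment_le\<close>). If the maximal age is already large at the start, the weights sum to
  at most one half, the inequality closes, and the increments are absolutely summable
  (\<open>increments_summable\<close>). In general the population is restarted in a generation in
  which the maximal age is large; as the mean population can be restarted in the same way,
  the two normalisations are comparable (\<open>mean_pop_size_restart\<close>).

  For positivity, the same inequality is quantitative: a population started from \<open>L\<close> newborns
  without immigration has a normalised limit within a random distance of order \<open>sqrt L\<close> from \<open>L\<close>,
  uniformly in the starting generation, so that its limit vanishes with probability at most of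
  order \<open>1 / sqrt L\<close>. The process with immigration dominates such a population
  as soon as some generation has \<open>L\<close> newborns (\<open>prob_not_surviving_le\<close>), and late
  generations have many newborns because the immigrants accumulate over the growing window of
  ages (\<open>newborns_unbounded_in_probability\<close>).

  Finally, individuals of age \<open>b\<close> are the newborns of \<open>b\<close> generations ago. Newborns make up a
  fraction \<open>m / g\<close> of the population up to the perturbation, and going back \<open>b\<close> generations costs a
  factor \<open>g ^ b\<close> (\<open>age_profile\<close>).
\<close>

section \<open>Linear recursions with a maximal age\<close>

definition pop_size :: "(nat \<Rightarrow> nat) \<Rightarrow> (nat \<Rightarrow> nat \<Rightarrow> real) \<Rightarrow> nat \<Rightarrow> real" where
  "pop_size a X n = (\<Sum>b\<le>a n. X n b)"

text \<open>
  Real-valued populations whose births are linear in the size. The perturbation \<open>e\<close> is arbitrary,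
  so that both the means of the branching process (\<open>e = 0\<close>) and its realizations are instances.
\<close>
definition linear_aging ::
  "(nat \<Rightarrow> nat) \<Rightarrow> real \<Rightarrow> (nat \<Rightarrow> nat \<Rightarrow> real) \<Rightarrow> (nat \<Rightarrow> real) \<Rightarrow> bool" where
  "linear_aging a m X e \<longleftrightarrow>
     (\<forall>n. X (Suc n) 0 = m * pop_size a X n + e (Suc n)) \<and>
     (\<forall>n b. X (Suc n) (Suc b) = (if Suc b \<le> a (Suc n) then X n b else 0))"

primrec mean_pop :: "(nat \<Rightarrow> nat) \<Rightarrow> real \<Rightarrow> nat \<Rightarrow> nat \<Rightarrow> real" where
  "mean_pop a m 0 = (\<lambda>b. if b = 0 then 1 else 0)"
| "mean_pop a m (Suc n) =
     (\<lambda>b. if b = 0 then m * (\<Sum>c\<le>a n. mean_pop a m n c)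
          else if b \<le> a (Suc n) then mean_pop a m n (b - 1) else 0)"

abbreviation mean_pop_size :: "(nat \<Rightarrow> nat) \<Rightarrow> real \<Rightarrow> nat \<Rightarrow> real" where
  "mean_pop_size a m \<equiv> pop_size a (mean_pop a m)"

lemma linear_aging_mean_pop: "linear_aging a m (mean_pop a m) (\<lambda>_. 0)"
  by (simp add: linear_aging_def pop_size_def)

lemma linear_aging_restart:
  assumes "linear_aging a m X e"
  shows "linear_aging (\<lambda>i. a (k + i)) m (\<lambda>i. X (k + i)) (\<lambda>i. e (k + i))"
  using assms by (simp add: linear_aging_def pop_size_def)

lemma pop_size_restart: "pop_size (\<lambda>i. a (k + i)) (\<lambda>i. X (k + i)) n = pop_size a X (k + n)"
  by (simp add: pop_size_def)

text \<open>
  Summing the inequality over \<open>n\<close> and exchanging the two sums, each \<open>v i\<close> on the right gets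
  overall weight at most \<open>\<kappa> / (1 - \<theta>) \<le> 1 / 2\<close>, so half of the sum on the left can be absorbed.
\<close>
lemma summable_of_geometric_memory:
  fixes v \<eta> :: "nat \<Rightarrow> real"
  assumes v: "\<And>n. 0 \<le> v n" and \<theta>: "0 < \<theta>" "\<theta> < 1" and \<kappa>: "0 \<le> \<kappa>" "\<kappa> / (1 - \<theta>) \<le> 1 / 2"
    and rec: "\<And>n. v n \<le> \<kappa> * (\<Sum>i<n. \<theta> ^ (n - 1 - i) * v i) + \<eta> n"
    and \<eta>: "\<And>n. 0 \<le> \<eta> n" "summable \<eta>"
  shows "summable v" and "suminf v \<le> 2 * suminf \<eta>"
proof -
  have *: "(\<Sum>n<N. v n) \<le> 2 * suminf \<eta>" for N
  proof -
    have "(\<Sum>n<N. \<Sum>i<n. \<theta> ^ (n - 1 - i) * v i) = (\<Sum>i<N. \<Sum>n=Suc i..<N. \<theta> ^ (n - 1 - i) * v i)"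
      by (subst sum.Sigma, simp, simp, subst sum.Sigma, simp, simp)
         (rule sum.reindex_bij_witness[of _ "\<lambda>(i,n). (n,i)" "\<lambda>(i,n). (n,i)"], auto)
    also have "\<dots> \<le> (\<Sum>i<N. v i * (1 / (1 - \<theta>)))"
    proof (rule sum_mono)
      fix i
      have "(\<Sum>n=Suc i..<N. \<theta> ^ (n - 1 - i)) = (\<Sum>j<N - Suc i. \<theta> ^ j)"
        by (rule sum.reindex_bij_witness[of _ "\<lambda>j. j + Suc i" "\<lambda>n. n - Suc i"]) auto
      also have "\<dots> \<le> (\<Sum>j. \<theta> ^ j)"
        using \<theta> by (intro sum_le_suminf) (auto simp: summable_geometric)
      also have "\<dots> = 1 / (1 - \<theta>)"
        using \<theta> by (simp add: suminf_geometric)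
      finally show "(\<Sum>n=Suc i..<N. \<theta> ^ (n - 1 - i) * v i) \<le> v i * (1 / (1 - \<theta>))"
        unfolding sum_distrib_right[symmetric] mult.commute[of "v i"] using v by (rule mult_right_mono)
    qed
    also have "\<dots> = (\<Sum>i<N. v i) / (1 - \<theta>)"
      by (simp add: sum_divide_distrib)
    finally have 1: "\<kappa> * (\<Sum>n<N. \<Sum>i<n. \<theta> ^ (n - 1 - i) * v i) \<le> \<kappa> * ((\<Sum>i<N. v i) / (1 - \<theta>))"
      using \<kappa>(1) by (rule mult_left_mono)
    have 2: "\<kappa> * ((\<Sum>i<N. v i) / (1 - \<theta>)) \<le> (1/2) * (\<Sum>i<N. v i)"
      using mult_right_mono[OF \<kappa>(2), of "\<Sum>i<N. v i"] v by (simp add: sum_nonneg)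
    have 3: "(\<Sum>n<N. \<eta> n) \<le> suminf \<eta>"
      using \<eta> by (intro sum_le_suminf) auto
    have "(\<Sum>n<N. v n) \<le> (\<Sum>n<N. \<kappa> * (\<Sum>i<n. \<theta> ^ (n - 1 - i) * v i) + \<eta> n)"
      by (rule sum_mono) (rule rec)
    also have "\<dots> = \<kappa> * (\<Sum>n<N. \<Sum>i<n. \<theta> ^ (n - 1 - i) * v i) + (\<Sum>n<N. \<eta> n)"
      by (simp add: sum.distrib sum_distrib_left)
    finally show ?thesis using 1 2 3 by linarith
  qed
  show s: "summable v"
    using v * by (rule summableI_nonneg_bounded)
  show "suminf v \<le> 2 * suminf \<eta>"
    using s * by (rule suminf_le_const)
qed

text \<open>
  Since the maximal age grows by at most one per generation, somebody who is too old to live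
  never becomes admissible again, and in each generation at most one age class dies.
\<close>
locale aging =
  fixes a :: "nat \<Rightarrow> nat" and m :: real
  assumes mono: "\<And>n. a n \<le> a (Suc n)"
    and step: "\<And>n. a (Suc n) \<le> a n + 1"
    and m_pos: "m > 0"
begin

definition deaths :: "(nat \<Rightarrow> nat \<Rightarrow> real) \<Rightarrow> nat \<Rightarrow> real" where
  "deaths X n = (if a (Suc n) = a n then X n (a n) else 0)"

lemma a_mono: "i \<le> n \<Longrightarrow> a i \<le> a n"
  using mono by (rule lift_Suc_mono_le)

lemma a_cases: "a (Suc n) = a n \<or> a (Suc n) = Suc (a n)"
  using mono[of n] step[of n] by linarith

lemma a_add_le: "a (k + i) \<le> a k + i"
proof (induction i)
  case (Suc i)
  then show ?case using step[of "k + i"] by simp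
qed simp

lemma pop_size_Suc:
  assumes "linear_aging a m X e"
  shows "pop_size a X (Suc n) = (1 + m) * pop_size a X n + e (Suc n) - deaths X n"
proof -
  have "pop_size a X (Suc n) = X (Suc n) 0 + (\<Sum>b<a (Suc n). X (Suc n) (Suc b))"
    unfolding pop_size_def by (simp add: sum.atMost_shift)
  also have "(\<Sum>b<a (Suc n). X (Suc n) (Suc b)) = (\<Sum>b<a (Suc n). X n b)"
    using assms by (intro sum.cong) (auto simp: linear_aging_def)
  also have "\<dots> = pop_size a X n - deaths X n"
    using a_cases[of n] by (auto simp: pop_size_def deaths_def lessThan_Suc_atMost)
      (simp add: lessThan_Suc_atMost[symmetric])
  finally show ?thesis
    using assms by (simp add: linear_aging_def algebra_simps)
qed

lemma living_is_birth:
  assumes "linear_aging a m X e" "b \<le> a n"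
  shows "X n b = (if b \<le> n then X (n - b) 0 else X 0 (b - n))"
  using assms(2)
proof (induction n arbitrary: b)
  case (Suc n)
  show ?case
  proof (cases b)
    case (Suc c)
    then have "X (Suc n) b = X n c"
      using assms(1) Suc.prems by (simp add: linear_aging_def)
    moreover have "c \<le> a n"
      using Suc Suc.prems step[of n] by simp
    ultimately show ?thesis using Suc.IH[of c] Suc by simp
  qed simp
qed simp

lemma mean_pop_nonneg: "0 \<le> mean_pop a m n b"
  using m_pos by (induction n arbitrary: b) (auto intro!: mult_nonneg_nonneg sum_nonneg)

lemma mean_pop_0_pos: "0 < mean_pop a m n 0"
proof (induction n)
  case (Suc n)
  then have "0 < (\<Sum>c\<le>a n. mean_pop a m n c)"
    by (intro sum_pos2[of _ 0]) (auto intro: mean_pop_nonneg)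
  then show ?case using m_pos by simp
qed simp

lemma mean_pop_size_pos: "0 < mean_pop_size a m n"
  unfolding pop_size_def
  by (intro sum_pos2[of _ 0]) (auto intro: mean_pop_nonneg mean_pop_0_pos)

lemma mean_pop_size_0: "mean_pop_size a m 0 = 1"
  by (simp add: pop_size_def)

text \<open>
  Without perturbation the recursion is linear and preserves order, so the individuals that
  are newborn at the start contribute their own mean progeny.
\<close>
lemma pop_size_ge_newborn_progeny:
  assumes lin: "linear_aging a m X (\<lambda>_. 0)" and nonneg: "\<And>b. 0 \<le> X 0 b"
  shows "X 0 0 * mean_pop_size a m n \<le> pop_size a X n"
proof -
  have "X 0 0 * mean_pop a m n b \<le> X n b" for n b
  proof (induction n arbitrary: b)
    case 0
    then show ?case using nonneg by simp
  next
    case (Suc n)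
    show ?case
    proof (cases b)
      case 0
      have "X 0 0 * (\<Sum>c\<le>a n. mean_pop a m n c) \<le> (\<Sum>c\<le>a n. X n c)"
        unfolding sum_distrib_left by (rule sum_mono) (rule Suc)
      then have "m * (X 0 0 * (\<Sum>c\<le>a n. mean_pop a m n c)) \<le> m * (\<Sum>c\<le>a n. X n c)"
        using m_pos by simp
      then show ?thesis
        using 0 lin by (simp add: linear_aging_def pop_size_def mult.left_commute)
    next
      case (Suc c)
      then show ?thesis
        using lin Suc.IH[of c] by (simp add: linear_aging_def)
    qed
  qed
  then show ?thesis
    unfolding pop_size_def sum_distrib_left by (intro sum_mono)
qed

text \<open>
  Somebody who dies in generation \<open>n\<close> was born in generation \<open>n - a n\<close>, which increases in each
  generation with deaths. Hence the ages of the initial population, which do not come from the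
  recursion, affect only finitely many death terms.
\<close>
lemma eventually_only_recorded_births_die:
  "\<exists>n0. \<forall>n\<ge>n0. a (Suc n) = a n \<longrightarrow> a n < n"
proof (cases "\<exists>n1. a n1 < n1")
  case True
  then obtain n1 where n1: "a n1 < n1" ..
  have "a n < n" if "n \<ge> n1" for n
    using a_add_le[of n1 "n - n1"] n1 that by simp
  then show ?thesis by blast
next
  case False
  then have ge: "n \<le> a n" for n by (meson not_less)
  \<comment> \<open>Now \<open>a n - n\<close> never increases, so it is constant after its minimum, and nobody dies there.\<close>
  obtain n0 where n0: "\<And>n. a n0 - n0 \<le> a n - n"
    using ex_has_least_nat[of "\<lambda>_. True" 0 "\<lambda>n. a n - n"] by auto
  have "a (Suc n) \<noteq> a n" if "n \<ge> n0" for n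
    using n0[of "Suc n"] a_add_le[of n0 "n - n0"] ge[of "Suc n"] ge[of n0] that by simp
  then show ?thesis by blast
qed

end

section \<open>Populations with a large maximal age from the start\<close>

text \<open>
  The two smallness conditions hold as soon as \<open>a 0\<close> is large. By \<open>few_deaths\<close> the deaths cannot
  push the growth factor of the mean population below \<open>\<rho>\<close>. By \<open>short_memory\<close> the influence of the
  past on the increments of normalised sizes has mass at most one half. The parameter
  \<open>\<theta> = 1 / sqrt \<rho>\<close> is a square root so that a death term, of size \<open>\<rho>\<close> to the power \<open>- a n\<close>, can
  be split into a factor that is small and a factor that decays with the delay.
\<close>
locale slow_aging = aging +
  fixes \<rho> \<theta> :: real
  assumes \<rho>: "1 < \<rho>" "\<rho> < 1 + m"
    and \<theta>: "0 < \<theta>" "\<theta> * \<theta> = 1 / \<rho>"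
    and few_deaths: "(1 + m) * (1 / \<rho>) ^ a 0 \<le> 1 + m - \<rho>"
    and short_memory: "(1 + m) * \<theta> ^ a 0 / (1 - \<theta>) \<le> 1 / 2"
begin

abbreviation "\<mu> \<equiv> mean_pop_size a m"

lemma \<theta>_less_1: "\<theta> < 1"
proof (rule ccontr)
  assume "\<not> \<theta> < 1"
  then have "1 * 1 \<le> \<theta> * \<theta>" by (intro mult_mono) auto
  then show False using \<theta> \<rho> by (simp add: divide_simps split: if_splits)
qed

lemma geometric_growth_aux:
  assumes "\<And>j. j < n \<Longrightarrow> \<rho> * \<mu> j \<le> \<mu> (Suc j)" "i \<le> n"
  shows "\<rho> ^ (n - i) * \<mu> i \<le> \<mu> n"
  using assms
proof (induction n)
  case (Suc n)
  show ?case
  proof (cases "i = Suc n")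
    case False
    then have "i \<le> n" using Suc.prems by simp
    then have "\<rho> ^ (n - i) * \<mu> i \<le> \<mu> n" using Suc by simp
    then have "\<rho> * (\<rho> ^ (n - i) * \<mu> i) \<le> \<rho> * \<mu> n" using \<rho> by simp
    also have "\<dots> \<le> \<mu> (Suc n)" using Suc.prems by simp
    finally show ?thesis using \<open>i \<le> n\<close> by (simp add: Suc_diff_le mult.assoc)
  qed simp
qed simp

text \<open>
  The dying class was born \<open>a n\<close> generations ago and equals \<open>m\<close> times the population one
  generation before that, which geometric growth makes smaller by a factor \<open>\<rho> ^ (a n + 1)\<close>. The
  growth is assumed only before generation \<open>n\<close>, because this bound is what proves it at \<open>n\<close>.
\<close>
lemma mean_deaths_le_aux:
  assumes "\<And>j. j < n \<Longrightarrow> \<rho> * \<mu> j \<le> \<mu> (Suc j)"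
  shows "deaths (mean_pop a m) n \<le> (1 + m) * (1 / \<rho>) ^ a n * \<mu> n"
proof -
  have pos: "0 < (1 + m) * (1 / \<rho>) ^ a n * \<mu> n"
    using m_pos \<rho> mean_pop_size_pos by simp
  consider "a n < n" | "a n = n" | "n < a n" by linarith
  then have "mean_pop a m n (a n) \<le> (1 + m) * (1 / \<rho>) ^ a n * \<mu> n"
  proof cases
    case 1
    define p where "p = n - Suc (a n)"
    have p: "n - a n = Suc p" "n - p = Suc (a n)" "p \<le> n"
      using 1 by (auto simp: p_def)
    have "mean_pop a m n (a n) = m * \<mu> p"
      using living_is_birth[OF linear_aging_mean_pop, of "a n" n] 1 p(1) by (simp add: pop_size_def)
    also have "\<dots> \<le> m * ((1 / \<rho>) ^ Suc (a n) * \<mu> n)"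
    proof -
      have "\<rho> ^ Suc (a n) * \<mu> p \<le> \<mu> n"
        using geometric_growth_aux[OF assms p(3)] p(2) by simp
      then show ?thesis
        using \<rho> m_pos by (simp add: power_one_over divide_simps mult_ac)
    qed
    also have "\<dots> \<le> (1 + m) * ((1 / \<rho>) ^ a n * \<mu> n)"
      using \<rho> m_pos mean_pop_size_pos[of n] by (intro mult_mono mult_right_mono power_decreasing) auto
    finally show ?thesis by (simp add: mult.assoc)
  next
    case 2
    have "mean_pop a m n (a n) = 1"
      using living_is_birth[OF linear_aging_mean_pop, of "a n" n] 2 by simp
    also have "\<dots> \<le> (1 / \<rho>) ^ a n * \<mu> n"
      using geometric_growth_aux[of n 0] assms 2 \<rho> by (simp add: mean_pop_size_0 power_one_over divide_simps)
    also have "\<dots> \<le> (1 + m) * ((1 / \<rho>) ^ a n * \<mu> n)"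
      using \<rho> m_pos mean_pop_size_pos[of n] by (simp add: zero_less_divide_iff)
    finally show ?thesis by (simp add: mult.assoc)
  next
    case 3
    then show ?thesis
      using living_is_birth[OF linear_aging_mean_pop, of "a n" n] pos by simp
  qed
  then show ?thesis using pos by (simp add: deaths_def)
qed

lemma mean_pop_size_growth_step: "\<rho> * \<mu> n \<le> \<mu> (Suc n)"
proof (induction n rule: less_induct)
  case (less n)
  have "(1 / \<rho>) ^ a n \<le> (1 / \<rho>) ^ a 0"
    using \<rho> a_mono by (intro power_decreasing) auto
  then have "(1 + m) * (1 / \<rho>) ^ a n \<le> 1 + m - \<rho>"
    using few_deaths m_pos by (smt (verit) mult_left_mono)
  then have "(1 + m) * (1 / \<rho>) ^ a n * \<mu> n \<le> (1 + m - \<rho>) * \<mu> n"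
    using mean_pop_size_pos[of n] by (intro mult_right_mono) auto
  then have "deaths (mean_pop a m) n \<le> (1 + m - \<rho>) * \<mu> n"
    using mean_deaths_le_aux[of n] less by simp
  then show ?case
    using pop_size_Suc[OF linear_aging_mean_pop, of n] by (simp add: algebra_simps)
qed

lemma mean_pop_size_growth: "i \<le> n \<Longrightarrow> \<rho> ^ (n - i) * \<mu> i \<le> \<mu> n"
  by (rule geometric_growth_aux) (auto intro: mean_pop_size_growth_step)

lemma mean_deaths_le: "deaths (mean_pop a m) n \<le> (1 + m) * (1 / \<rho>) ^ a n * \<mu> n"
  by (rule mean_deaths_le_aux) (auto intro: mean_pop_size_growth_step)

lemma mean_deaths_nonneg: "0 \<le> deaths (mean_pop a m) n"
  by (simp add: deaths_def mean_pop_nonneg)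

text \<open>
  With \<open>u n\<close> the normalised size, the reproduction terms cancel in \<open>u (n + 1) - u n\<close>. What remains
  is the new perturbation and the difference between the deaths and \<open>u n\<close> times the mean deaths.
  The dying class was \<open>m\<close> times the population in generation \<open>p = n - a n - 1\<close> plus a
  perturbation, so this difference is the mean number of deaths times \<open>u p - u n\<close>, a telescoping
  sum of earlier increments, plus an old perturbation.
\<close>
lemma increment_le:
  fixes X e
  defines "u \<equiv> \<lambda>n. pop_size a X n / \<mu> n"
  defines "v \<equiv> \<lambda>n. \<bar>u (Suc n) - u n\<bar>"
  defines "s \<equiv> \<lambda>n. \<bar>e (Suc n)\<bar> / \<mu> (Suc n)"
  assumes lin: "linear_aging a m X e"
    and H: "a (Suc n) = a n \<Longrightarrow> a n < n \<or> (\<forall>b>0. X 0 b = 0)"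
  shows "v n \<le> (1 + m) * \<theta> ^ a 0 * (\<Sum>i<n. \<theta> ^ (n - 1 - i) * v i) + (\<Sum>i\<le>n. (1 / \<rho>) ^ (n - i) * s i)"
proof -
  let ?d = "deaths (mean_pop a m) n" and ?E = "\<Sum>i<n. (1 / \<rho>) ^ (n - i) * s i"
    and ?V = "\<Sum>i=n - Suc (a n)..<n. v i"
  have \<mu>: "\<mu> i > 0" for i by (rule mean_pop_size_pos)
  have s0: "0 \<le> s i" for i using \<mu> by (simp add: s_def less_imp_le)
  have v0: "0 \<le> v i" for i by (simp add: v_def)
  have E0: "0 \<le> ?E" using s0 \<rho> by (intro sum_nonneg) simp
  have d0: "0 \<le> ?d" by (rule mean_deaths_nonneg)
  have rhs0: "0 \<le> ?d * ?V + \<mu> (Suc n) * ?E"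
    by (intro add_nonneg_nonneg mult_nonneg_nonneg[OF d0 sum_nonneg] mult_nonneg_nonneg[OF less_imp_le[OF \<mu>] E0] v0)
  have V0: "0 \<le> ?V" using v0 by (rule sum_nonneg)
  have tele: "\<bar>u p - u n\<bar> \<le> (\<Sum>i=p..<n. v i)" if "p \<le> n" for p
  proof -
    have "u n - u p = (\<Sum>i=p..<n. u (Suc i) - u i)"
      using that by (simp add: sum_Suc_diff')
    then show ?thesis
      unfolding v_def using sum_abs[of "\<lambda>i. u (Suc i) - u i" "{p..<n}"] by linarith
  qed
  have D: "\<bar>deaths X n - ?d * u n\<bar> \<le> ?d * ?V + \<mu> (Suc n) * ?E"
  proof (cases "a (Suc n) = a n")
    case False
    then show ?thesis using rhs0 by (simp add: deaths_def)
  next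
    case same: True
    consider "a n < n" | "a n = n" "\<forall>b>0. X 0 b = 0" | "n < a n" "\<forall>b>0. X 0 b = 0"
      using H[OF same] nat_neq_iff[of "a n" n] by blast
    then show ?thesis
    proof cases
      case 1
      define p where "p = n - Suc (a n)"
      have p: "n - a n = Suc p" "n - p = Suc (a n)" "p < n"
        using 1 by (auto simp: p_def)
      have dX: "deaths X n = m * pop_size a X p + e (Suc p)"
        using living_is_birth[OF lin, of "a n" n] same p(1) lin 1 by (simp add: deaths_def linear_aging_def)
      have d: "?d = m * \<mu> p"
        using living_is_birth[OF linear_aging_mean_pop, of "a n" n] same p(1) 1
        by (simp add: deaths_def pop_size_def)
      have "deaths X n - ?d * u n = ?d * (u p - u n) + e (Suc p)"
        unfolding dX d u_def using \<mu>[of p] by (simp add: field_simps)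
      also have "\<bar>\<dots>\<bar> \<le> ?d * \<bar>u p - u n\<bar> + \<bar>e (Suc p)\<bar>"
        using d0 by (metis abs_mult abs_of_nonneg abs_triangle_ineq)
      also have "?d * \<bar>u p - u n\<bar> \<le> ?d * ?V"
        using d0 tele[of p] p(3) by (intro mult_left_mono) (auto simp: p_def)
      also have "\<bar>e (Suc p)\<bar> \<le> \<mu> (Suc n) * ((1 / \<rho>) ^ (n - p) * s p)"
      proof -
        have "\<rho> ^ (n - p) * \<mu> (Suc p) \<le> \<mu> (Suc n)"
          using mean_pop_size_growth[of "Suc p" "Suc n"] p(3) by simp
        then have "\<rho> ^ (n - p) * \<mu> (Suc p) * s p \<le> \<mu> (Suc n) * s p"
          using s0 by (rule mult_right_mono)
        then have "\<rho> ^ (n - p) * \<bar>e (Suc p)\<bar> \<le> \<mu> (Suc n) * s p"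
          using \<mu>[of "Suc p"] by (simp add: s_def mult.assoc)
        then show ?thesis
          using \<rho> by (simp add: power_one_over divide_simps mult_ac)
      qed
      also have "\<dots> \<le> \<mu> (Suc n) * ?E"
        using p(3) s0 \<rho> \<mu>[of "Suc n"]
        by (intro mult_left_mono member_le_sum) auto
      finally show ?thesis by simp
    next
      case 2
      have dX: "deaths X n = u 0"
        using living_is_birth[OF lin, of "a n" n] same 2 by (simp add: deaths_def u_def mean_pop_size_0 pop_size_def sum.atMost_shift)
      have d: "?d = 1"
        using living_is_birth[OF linear_aging_mean_pop, of "a n" n] same 2 by (simp add: deaths_def)
      show ?thesis
        using tele[of 0] dX d 2(1) E0 \<mu>[of "Suc n"] by (simp add: add_increasing2)
    next
      case 3
      then show ?thesis
        using living_is_birth[OF lin, of "a n" n] living_is_birth[OF linear_aging_mean_pop, of "a n" n] E0 \<mu>[of "Suc n"]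
        by (simp add: deaths_def)
    qed
  qed
  have small: "?d \<le> \<mu> (Suc n) * ((1 + m) * (1 / \<rho>) ^ a n)"
  proof -
    have "?d \<le> (1 + m) * (1 / \<rho>) ^ a n * \<mu> n" by (rule mean_deaths_le)
    also have "\<mu> n \<le> \<mu> (Suc n)"
      using mean_pop_size_growth_step[of n] \<rho> \<mu>[of n] by (smt (verit) mult_le_cancel_right1)
    finally show ?thesis using m_pos \<rho> by (simp add: mult.commute mult_left_mono)
  qed
  have kernel: "(1 + m) * (1 / \<rho>) ^ a n * ?V \<le> (1 + m) * \<theta> ^ a 0 * (\<Sum>i<n. \<theta> ^ (n - 1 - i) * v i)"
  proof -
    have "(1 / \<rho>) ^ a n * ?V = (\<Sum>i=n - Suc (a n)..<n. (1 / \<rho>) ^ a n * v i)"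
      by (rule sum_distrib_left)
    also have "\<dots> \<le> (\<Sum>i=n - Suc (a n)..<n. \<theta> ^ a 0 * (\<theta> ^ (n - 1 - i) * v i))"
    proof (rule sum_mono)
      fix i assume "i \<in> {n - Suc (a n)..<n}"
      \<comment> \<open>The delay is at most \<open>a n\<close>, and so is \<open>a 0\<close>; hence \<open>a n\<close> bounds half of their sum.\<close>
      then have "a 0 + (n - 1 - i) \<le> a n + a n" using a_mono[of 0 n] by auto
      then have "\<theta> ^ (a n + a n) \<le> \<theta> ^ (a 0 + (n - 1 - i))"
        using \<theta> \<theta>_less_1 by (intro power_decreasing) auto
      moreover have "\<theta> ^ (a n + a n) = (1 / \<rho>) ^ a n"
        by (simp add: power_add power_mult_distrib[symmetric] \<theta>)
      ultimately show "(1 / \<rho>) ^ a n * v i \<le> \<theta> ^ a 0 * (\<theta> ^ (n - 1 - i) * v i)"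
        using v0[of i] by (simp add: power_add mult.assoc[symmetric] mult_right_mono)
    qed
    also have "\<dots> \<le> (\<Sum>i<n. \<theta> ^ a 0 * (\<theta> ^ (n - 1 - i) * v i))"
      using \<theta> v0 by (intro sum_mono2) auto
    finally show ?thesis
      using m_pos by (simp add: sum_distrib_left[symmetric] mult.assoc)
  qed
  have "u n * \<mu> (Suc n) = (1 + m) * (u n * \<mu> n) - ?d * u n"
    unfolding pop_size_Suc[OF linear_aging_mean_pop] by (simp add: algebra_simps)
  also have "u n * \<mu> n = pop_size a X n"
    using \<mu>[of n] by (simp add: u_def)
  finally have "u n * \<mu> (Suc n) = (1 + m) * pop_size a X n - ?d * u n" .
  then have "pop_size a X (Suc n) - u n * \<mu> (Suc n) = e (Suc n) - (deaths X n - ?d * u n)"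
    using pop_size_Suc[OF lin, of n] by simp
  then have "u (Suc n) - u n = (e (Suc n) - (deaths X n - ?d * u n)) / \<mu> (Suc n)"
    using \<mu>[of "Suc n"] by (simp add: u_def field_simps)
  then have "v n \<le> (\<bar>e (Suc n)\<bar> + \<bar>deaths X n - ?d * u n\<bar>) / \<mu> (Suc n)"
    using \<mu>[of "Suc n"] by (simp add: v_def divide_right_mono abs_triangle_ineq4)
  also have "\<dots> \<le> (\<bar>e (Suc n)\<bar> + (\<mu> (Suc n) * ((1 + m) * (1 / \<rho>) ^ a n) * ?V + \<mu> (Suc n) * ?E)) / \<mu> (Suc n)"
    using D mult_right_mono[OF small V0] \<mu>[of "Suc n"]
    by (intro divide_right_mono add_left_mono) linarith+
  also have "\<dots> = s n + ((1 + m) * (1 / \<rho>) ^ a n * ?V + ?E)"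
    using \<mu>[of "Suc n"] by (simp add: s_def field_simps)
  also have "s n + ((1 + m) * (1 / \<rho>) ^ a n * ?V + ?E) = (1 + m) * (1 / \<rho>) ^ a n * ?V + (\<Sum>i\<le>n. (1 / \<rho>) ^ (n - i) * s i)"
    by (simp add: lessThan_Suc_atMost[symmetric])
  finally show ?thesis using kernel by linarith
qed

lemma increments_summable:
  fixes X e
  defines "v \<equiv> \<lambda>n. \<bar>pop_size a X (Suc n) / \<mu> (Suc n) - pop_size a X n / \<mu> n\<bar>"
  defines "s \<equiv> \<lambda>n. \<bar>e (Suc n)\<bar> / \<mu> (Suc n)"
  assumes lin: "linear_aging a m X e" and s: "summable s"
  shows "summable v"
    and "(\<And>b. b > 0 \<Longrightarrow> X 0 b = 0) \<Longrightarrow> suminf v \<le> 2 / (1 - 1 / \<rho>) * suminf s"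
proof -
  define c where "c n = (\<Sum>i\<le>n. s i * (1 / \<rho>) ^ (n - i))" for n
  have \<mu>: "\<mu> i > 0" for i by (rule mean_pop_size_pos)
  have s0: "0 \<le> s i" for i using \<mu> by (simp add: s_def less_imp_le)
  have geo: "summable (\<lambda>n. (1 / \<rho>) ^ n)" using \<rho> by (simp add: summable_geometric)
  have n1: "summable (\<lambda>n. norm (s n))" using s s0 by simp
  have n2: "summable (\<lambda>n. norm ((1 / \<rho>) ^ n))" using geo \<rho> by simp
  have c: "summable c" "suminf c = suminf s * (1 / (1 - 1 / \<rho>))"
    using summable_Cauchy_product[OF n1 n2] Cauchy_product[OF n1 n2] \<rho>
    unfolding c_def by (auto simp: suminf_geometric)
  have c0: "0 \<le> c n" for n
    unfolding c_def using s0 \<rho> by (intro sum_nonneg) simp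
  have v0: "0 \<le> v n" for n by (simp add: v_def)
  have rec: "v n \<le> (1 + m) * \<theta> ^ a 0 * (\<Sum>i<n. \<theta> ^ (n - 1 - i) * v i) + c n"
    if "a (Suc n) = a n \<Longrightarrow> a n < n \<or> (\<forall>b>0. X 0 b = 0)" for n
    using increment_le[OF lin that] unfolding v_def s_def c_def by (simp add: mult.commute)
  have \<kappa>: "0 \<le> (1 + m) * \<theta> ^ a 0" using m_pos \<theta> by simp
  obtain n0 where n0: "\<And>n. n \<ge> n0 \<Longrightarrow> a (Suc n) = a n \<Longrightarrow> a n < n"
    using eventually_only_recorded_births_die by blast
  \<comment> \<open>The finitely many generations in which members of the initial population may die are put into the source term.\<close>
  define \<eta> where "\<eta> n = (if n < n0 then v n else c n)" for n
  have "summable \<eta>"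
    using c(1) by (rule summable_cong[THEN iffD1, rotated])
      (auto simp: \<eta>_def eventually_sequentially intro!: exI[of _ n0])
  moreover have "v n \<le> (1 + m) * \<theta> ^ a 0 * (\<Sum>i<n. \<theta> ^ (n - 1 - i) * v i) + \<eta> n" for n
  proof (cases "n < n0")
    case True
    have "0 \<le> (1 + m) * \<theta> ^ a 0 * (\<Sum>i<n. \<theta> ^ (n - 1 - i) * v i)"
      using \<theta> v0 by (intro mult_nonneg_nonneg[OF \<kappa> sum_nonneg]) auto
    then show ?thesis using True by (simp add: \<eta>_def)
  next
    case False
    then show ?thesis using rec[of n] n0[of n] by (simp add: \<eta>_def)
  qed
  moreover have "0 \<le> \<eta> n" for n using v0 c0 by (simp add: \<eta>_def)
  ultimately show "summable v"
    using summable_of_geometric_memory(1)[of v \<theta> "(1 + m) * \<theta> ^ a 0" \<eta>]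
      v0 \<theta>(1) \<theta>_less_1 \<kappa> short_memory by blast
  show "suminf v \<le> 2 / (1 - 1 / \<rho>) * suminf s" if "\<And>b. b > 0 \<Longrightarrow> X 0 b = 0"
  proof -
    have "suminf v \<le> 2 * suminf c"
      using rec that by (intro summable_of_geometric_memory(2)[OF v0 \<theta>(1) \<theta>_less_1 \<kappa> short_memory _ c0 c(1)]) auto
    then show ?thesis by (simp add: c(2) field_simps)
  qed
qed

text \<open>
  Absolutely summable increments give convergence. For a population that consists of newborns at
  the start, the estimate also says how far the limit can be from the initial size, with a
  constant that does not depend on the ages; this is what makes the limit positive later.
\<close>
lemma ratio_convergent:
  assumes lin: "linear_aging a m X e" and s: "summable (\<lambda>n. \<bar>e (Suc n)\<bar> / \<mu> (Suc n))"
  shows "convergent (\<lambda>n. pop_size a X n / \<mu> n)"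
    and "(\<And>b. b > 0 \<Longrightarrow> X 0 b = 0) \<Longrightarrow>
      \<bar>lim (\<lambda>n. pop_size a X n / \<mu> n) - X 0 0\<bar> \<le> 2 / (1 - 1 / \<rho>) * (\<Sum>n. \<bar>e (Suc n)\<bar> / \<mu> (Suc n))"
proof -
  define u where "u n = pop_size a X n / \<mu> n" for n
  have v: "summable (\<lambda>n. \<bar>u (Suc n) - u n\<bar>)"
    unfolding u_def by (rule increments_summable(1)[OF lin s])
  then have "summable (\<lambda>n. u (Suc n) - u n)" by (rule summable_rabs_cancel)
  then have "(\<lambda>n. \<Sum>i<n. u (Suc i) - u i) \<longlonglongrightarrow> (\<Sum>n. u (Suc n) - u n)"
    by (rule summable_LIMSEQ)
  then have "(\<lambda>n. u n - u 0) \<longlonglongrightarrow> (\<Sum>n. u (Suc n) - u n)"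
    by (simp add: sum_lessThan_telescope)
  from tendsto_add[OF this tendsto_const[of "u 0"]]
  have l: "u \<longlonglongrightarrow> (\<Sum>n. u (Suc n) - u n) + u 0" by simp
  then show "convergent (\<lambda>n. pop_size a X n / \<mu> n)"
    unfolding u_def by (rule convergentI)
  assume nb: "\<And>b. b > 0 \<Longrightarrow> X 0 b = 0"
  have "\<bar>lim u - X 0 0\<bar> = \<bar>\<Sum>n. u (Suc n) - u n\<bar>"
    using limI[OF l] nb by (simp add: u_def mean_pop_size_0 pop_size_def sum.atMost_shift)
  also have "\<dots> \<le> (\<Sum>n. \<bar>u (Suc n) - u n\<bar>)"
    by (rule summable_rabs[OF v])
  also have "\<dots> \<le> 2 / (1 - 1 / \<rho>) * (\<Sum>n. \<bar>e (Suc n)\<bar> / \<mu> (Suc n))"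
    unfolding u_def by (rule increments_summable(2)[OF lin s nb])
  finally show "\<bar>lim (\<lambda>n. pop_size a X n / \<mu> n) - X 0 0\<bar> \<le> 2 / (1 - 1 / \<rho>) * (\<Sum>n. \<bar>e (Suc n)\<bar> / \<mu> (Suc n))"
    by (simp add: u_def[abs_def])
qed

lemma mean_pop_size_ge: "\<rho> ^ n \<le> \<mu> n"
  using mean_pop_size_growth[of 0 n] by (simp add: mean_pop_size_0)

lemma mean_pop_size_ratio:
  assumes lim: "filterlim a at_top sequentially"
  shows "(\<lambda>n. \<mu> (Suc n) / \<mu> n) \<longlonglongrightarrow> 1 + m"
proof -
  have "(\<lambda>n. (1 / \<rho>) ^ a n) \<longlonglongrightarrow> 0"
    using \<rho> by (intro filterlim_compose[OF LIMSEQ_realpow_zero lim]) auto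
  then have "(\<lambda>n. (1 + m) * (1 / \<rho>) ^ a n) \<longlonglongrightarrow> 0"
    by (rule tendsto_mult_right_zero)
  then have "(\<lambda>n. deaths (mean_pop a m) n / \<mu> n) \<longlonglongrightarrow> 0"
    by (rule real_tendsto_sandwich[OF _ _ tendsto_const, rotated 2])
      (use mean_deaths_nonneg mean_deaths_le mean_pop_size_pos in
        \<open>auto simp: pos_divide_le_eq less_imp_le intro!: always_eventually\<close>)
  then have "(\<lambda>n. 1 + m - deaths (mean_pop a m) n / \<mu> n) \<longlonglongrightarrow> 1 + m - 0"
    by (intro tendsto_diff tendsto_const)
  moreover have "\<mu> (Suc n) / \<mu> n = 1 + m - deaths (mean_pop a m) n / \<mu> n" for n
    using pop_size_Suc[OF linear_aging_mean_pop, of n] mean_pop_size_pos[of n] by (simp add: field_simps)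
  ultimately show ?thesis by simp
qed

end

section \<open>Restarting in a late generation\<close>

lemma slow_agingI_eventually:
  fixes m \<rho> :: real
  assumes "m > 0" "1 < \<rho>" "\<rho> < 1 + m"
  shows "\<exists>A. \<forall>a. aging a m \<longrightarrow> A \<le> a 0 \<longrightarrow> slow_aging a m \<rho> (1 / sqrt \<rho>)"
proof -
  define \<theta> where "\<theta> = 1 / sqrt \<rho>"
  have \<theta>: "0 < \<theta>" "\<theta> < 1" "\<theta> * \<theta> = 1 / \<rho>"
    using assms by (auto simp: \<theta>_def)
  have "(\<lambda>n. (1 + m) * (1 / \<rho>) ^ n) \<longlonglongrightarrow> (1 + m) * 0"
    using assms by (intro tendsto_mult tendsto_const LIMSEQ_realpow_zero) auto
  then have 1: "\<forall>\<^sub>F n in sequentially. (1 + m) * (1 / \<rho>) ^ n < 1 + m - \<rho>"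
    by (rule order_tendstoD(2)) (use assms in simp)
  have "(\<lambda>n. (1 + m) * \<theta> ^ n / (1 - \<theta>)) \<longlonglongrightarrow> (1 + m) * 0 / (1 - \<theta>)"
    using \<theta> by (intro tendsto_divide tendsto_mult tendsto_const LIMSEQ_realpow_zero) auto
  then have 2: "\<forall>\<^sub>F n in sequentially. (1 + m) * \<theta> ^ n / (1 - \<theta>) < 1 / 2"
    by (rule order_tendstoD(2)) simp
  from eventually_conj[OF 1 2] obtain A
    where A: "\<And>n. A \<le> n \<Longrightarrow> (1 + m) * (1 / \<rho>) ^ n < 1 + m - \<rho> \<and> (1 + m) * \<theta> ^ n / (1 - \<theta>) < 1 / 2"
    by (auto simp: eventually_sequentially)
  have "slow_aging a m \<rho> \<theta>" if "aging a m" "A \<le> a 0" for a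
    using that assms \<theta> A[of "a 0"] by (simp add: slow_aging_def slow_aging_axioms_def)
  then show ?thesis unfolding \<theta>_def by blast
qed

locale unbounded_aging = aging +
  fixes \<rho> :: real
  assumes \<rho>: "1 < \<rho>" "\<rho> < 1 + m"
    and a_lim: "filterlim a at_top sequentially"
begin

abbreviation slow_from :: "nat \<Rightarrow> bool" where
  "slow_from k \<equiv> slow_aging (\<lambda>i. a (k + i)) m \<rho> (1 / sqrt \<rho>)"

lemma aging_restart: "aging (\<lambda>i. a (k + i)) m"
  using mono step m_pos by unfold_locales auto

lemma eventually_slow: "\<exists>k0. \<forall>k\<ge>k0. slow_from k"
proof -
  obtain A where A: "\<And>a. aging a m \<Longrightarrow> A \<le> a 0 \<Longrightarrow> slow_aging a m \<rho> (1 / sqrt \<rho>)"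
    using slow_agingI_eventually[OF m_pos \<rho>] by blast
  have "\<forall>\<^sub>F k in sequentially. A \<le> a k"
    using a_lim by (simp add: filterlim_at_top)
  then show ?thesis
    using A[OF aging_restart] by (auto simp: eventually_sequentially)
qed

text \<open>
  The mean population from generation \<open>k\<close> on is an unperturbed population of the restarted
  recursion, so its size divided by that of the restarted mean population converges. The limit
  is positive because the newborns of generation \<open>k\<close> alone contribute a multiple of the
  restarted mean population.
\<close>
lemma mean_pop_size_restart:
  assumes "slow_from k"
  shows "\<exists>c>0. (\<lambda>i. mean_pop_size a m (k + i) / mean_pop_size (\<lambda>i. a (k + i)) m i) \<longlonglongrightarrow> c"
    and "mean_pop a m k 0 * mean_pop_size (\<lambda>i. a (k + i)) m i \<le> mean_pop_size a m (k + i)"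
proof -
  interpret S: slow_aging "\<lambda>i. a (k + i)" m \<rho> "1 / sqrt \<rho>" by fact
  note lin = linear_aging_restart[OF linear_aging_mean_pop[of a m], of k]
  have ge: "mean_pop a m k 0 * S.\<mu> i \<le> mean_pop_size a m (k + i)" for i
    using S.pop_size_ge_newborn_progeny[OF lin, of i] mean_pop_nonneg
    by (simp add: pop_size_restart)
  then show "mean_pop a m k 0 * S.\<mu> i \<le> mean_pop_size a m (k + i)" .
  obtain c where c: "(\<lambda>i. mean_pop_size a m (k + i) / S.\<mu> i) \<longlonglongrightarrow> c"
    using S.ratio_convergent(1)[OF lin] by (auto simp: pop_size_restart convergent_def)
  have "mean_pop a m k 0 \<le> c"
    using c by (rule LIMSEQ_le_const)
      (use ge S.mean_pop_size_pos in \<open>auto simp: pos_le_divide_eq\<close>)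
  then show "\<exists>c>0. (\<lambda>i. mean_pop_size a m (k + i) / S.\<mu> i) \<longlonglongrightarrow> c"
    using c mean_pop_0_pos[of k] by (intro exI[of _ c]) auto
qed

lemma eventually_mean_pop_size_ge:
  "\<exists>c>0. \<forall>\<^sub>F n in sequentially. c * \<rho> ^ n \<le> mean_pop_size a m n"
proof -
  obtain k where k: "slow_from k" using eventually_slow by blast
  then interpret S: slow_aging "\<lambda>i. a (k + i)" m \<rho> "1 / sqrt \<rho>" .
  have "mean_pop a m k 0 / \<rho> ^ k * \<rho> ^ n \<le> mean_pop_size a m n" if "n \<ge> k" for n
  proof -
    have "mean_pop a m k 0 / \<rho> ^ k * \<rho> ^ n = mean_pop a m k 0 * \<rho> ^ (n - k)"
      using that \<rho> by (simp add: power_diff)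
    also have "\<dots> \<le> mean_pop a m k 0 * S.\<mu> (n - k)"
      using mean_pop_0_pos[of k] S.mean_pop_size_ge by (intro mult_left_mono) auto
    also have "\<dots> \<le> mean_pop_size a m n"
      using mean_pop_size_restart(2)[OF k, of "n - k"] that by simp
    finally show ?thesis .
  qed
  then show ?thesis
    using mean_pop_0_pos[of k] \<rho>
    by (intro exI[of _ "mean_pop a m k 0 / \<rho> ^ k"]) (auto simp: eventually_sequentially)
qed

lemma mean_pop_size_ratio: "(\<lambda>n. mean_pop_size a m (Suc n) / mean_pop_size a m n) \<longlonglongrightarrow> 1 + m"
proof -
  obtain k where k: "slow_from k" using eventually_slow by blast
  then interpret S: slow_aging "\<lambda>i. a (k + i)" m \<rho> "1 / sqrt \<rho>" .
  obtain c where c: "c > 0" "(\<lambda>i. mean_pop_size a m (k + i) / S.\<mu> i) \<longlonglongrightarrow> c"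
    using mean_pop_size_restart(1)[OF k] by blast
  have "filterlim (\<lambda>i. a (i + k)) at_top sequentially"
    using a_lim by (rule filterlim_compose) (rule filterlim_add_const_nat_at_top)
  then have S: "(\<lambda>i. S.\<mu> (Suc i) / S.\<mu> i) \<longlonglongrightarrow> 1 + m"
    using S.mean_pop_size_ratio by (simp add: add.commute)
  have "(\<lambda>i. (mean_pop_size a m (k + Suc i) / S.\<mu> (Suc i)) / (mean_pop_size a m (k + i) / S.\<mu> i)
      * (S.\<mu> (Suc i) / S.\<mu> i)) \<longlonglongrightarrow> c / c * (1 + m)"
    using c(1) LIMSEQ_Suc[OF c(2)] by (intro tendsto_mult tendsto_divide c S) auto
  moreover have "(mean_pop_size a m (k + Suc i) / S.\<mu> (Suc i)) / (mean_pop_size a m (k + i) / S.\<mu> i)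
      * (S.\<mu> (Suc i) / S.\<mu> i) = mean_pop_size a m (Suc (i + k)) / mean_pop_size a m (i + k)" for i
    using S.mean_pop_size_pos[of i] S.mean_pop_size_pos[of "Suc i"] by (simp add: field_simps)
  ultimately have "(\<lambda>i. mean_pop_size a m (Suc (i + k)) / mean_pop_size a m (i + k)) \<longlonglongrightarrow> 1 + m"
    using c(1) by simp
  then show ?thesis by (rule LIMSEQ_offset)
qed

lemma pop_size_over_mean_convergent:
  assumes lin: "linear_aging a m X e" and s: "summable (\<lambda>n. \<bar>e n\<bar> / \<rho> ^ n)"
  shows "convergent (\<lambda>n. pop_size a X n / mean_pop_size a m n)"
proof -
  obtain k where k: "slow_from k" using eventually_slow by blast
  then interpret S: slow_aging "\<lambda>i. a (k + i)" m \<rho> "1 / sqrt \<rho>" .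
  obtain c where c: "c > 0" "(\<lambda>i. mean_pop_size a m (k + i) / S.\<mu> i) \<longlonglongrightarrow> c"
    using mean_pop_size_restart(1)[OF k] by blast
  have "summable (\<lambda>i. \<bar>e (i + Suc k)\<bar> / \<rho> ^ (i + Suc k) * \<rho> ^ k)"
    using summable_ignore_initial_segment[OF s, of "Suc k"] by (rule summable_mult2)
  then have "summable (\<lambda>i. \<bar>e (k + Suc i)\<bar> / S.\<mu> (Suc i))"
  proof (rule summable_comparison_test'[where N = 0])
    fix i
    have "\<bar>e (k + Suc i)\<bar> / S.\<mu> (Suc i) \<le> \<bar>e (k + Suc i)\<bar> / \<rho> ^ Suc i"
      using S.mean_pop_size_ge[of "Suc i"] \<rho> by (intro divide_left_mono) (auto simp: S.mean_pop_size_pos)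
    also have "\<dots> = \<bar>e (i + Suc k)\<bar> / \<rho> ^ (i + Suc k) * \<rho> ^ k"
      using \<rho> by (simp add: power_add add_ac)
    finally show "norm (\<bar>e (k + Suc i)\<bar> / S.\<mu> (Suc i)) \<le> \<bar>e (i + Suc k)\<bar> / \<rho> ^ (i + Suc k) * \<rho> ^ k"
      using S.mean_pop_size_pos[of "Suc i"] by (simp add: abs_of_pos)
  qed
  from S.ratio_convergent(1)[OF linear_aging_restart[OF lin] this]
  obtain l where l: "(\<lambda>i. pop_size a X (k + i) / S.\<mu> i) \<longlonglongrightarrow> l"
    by (auto simp: pop_size_restart convergent_def)
  have "(\<lambda>i. (pop_size a X (k + i) / S.\<mu> i) / (mean_pop_size a m (k + i) / S.\<mu> i)) \<longlonglongrightarrow> l / c"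
    using c l by (intro tendsto_divide) auto
  moreover have "(pop_size a X (k + i) / S.\<mu> i) / (mean_pop_size a m (k + i) / S.\<mu> i)
      = pop_size a X (i + k) / mean_pop_size a m (i + k)" for i
    using S.mean_pop_size_pos[of i] by (simp add: add.commute)
  ultimately have "(\<lambda>i. pop_size a X (i + k) / mean_pop_size a m (i + k)) \<longlonglongrightarrow> l / c" by simp
  then show ?thesis by (intro convergentI) (rule LIMSEQ_offset)
qed

text \<open>
  A subpopulation that lives from generation \<open>k\<close> on is naturally compared with the mean population
  restarted in generation \<open>k\<close>; both normalisations agree up to a positive constant.
\<close>
lemma limit_pos_of_growing_subpopulation:
  assumes k: "slow_from k"
    and y: "(\<lambda>i. y i / mean_pop_size (\<lambda>i. a (k + i)) m i) \<longlonglongrightarrow> l" "0 < l"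
    and le: "\<And>i. y i \<le> x (k + i)"
    and W: "(\<lambda>n. x n / mean_pop_size a m n) \<longlonglongrightarrow> W"
  shows "0 < W"
proof -
  interpret S: slow_aging "\<lambda>i. a (k + i)" m \<rho> "1 / sqrt \<rho>" by fact
  obtain c where c: "c > 0" "(\<lambda>i. mean_pop_size a m (k + i) / S.\<mu> i) \<longlonglongrightarrow> c"
    using mean_pop_size_restart(1)[OF k] by blast
  have 1: "(\<lambda>i. (y i / S.\<mu> i) / (mean_pop_size a m (k + i) / S.\<mu> i)) \<longlonglongrightarrow> l / c"
    using c y by (intro tendsto_divide) auto
  have 2: "(\<lambda>i. x (k + i) / mean_pop_size a m (k + i)) \<longlonglongrightarrow> W"
    using LIMSEQ_ignore_initial_segment[OF W, of k] by (simp add: add.commute)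
  have "(y i / S.\<mu> i) / (mean_pop_size a m (k + i) / S.\<mu> i) \<le> x (k + i) / mean_pop_size a m (k + i)" for i
    using S.mean_pop_size_pos[of i] mean_pop_size_pos[of "k + i"] le[of i] by (simp add: divide_right_mono)
  then have "l / c \<le> W"
    using LIMSEQ_le[OF 1 2] by blast
  moreover have "0 < l / c" using c y by simp
  ultimately show ?thesis by linarith
qed

text \<open>
  The newborns of generation \<open>n\<close> are \<open>m\<close> times the population of generation \<open>n - 1\<close> up to
  a negligible perturbation, and those of age \<open>b\<close> are the newborns of \<open>b\<close> generations earlier.
\<close>
lemma age_profile:
  assumes lin: "linear_aging a m X e" and s: "summable (\<lambda>n. \<bar>e n\<bar> / \<rho> ^ n)"
    and W: "(\<lambda>n. pop_size a X n / mean_pop_size a m n) \<longlonglongrightarrow> W" "W \<noteq> 0"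
  shows "(\<lambda>n. X n b / pop_size a X n) \<longlonglongrightarrow> m / (m + 1) ^ (b + 1)"
proof -
  let ?M = "mean_pop_size a m"
  have pos: "?M n > 0" for n by (rule mean_pop_size_pos)
  have lag: "(\<lambda>n. ?M n / ?M (n + b)) \<longlonglongrightarrow> (1 / (1 + m)) ^ b" for b
  proof (induction b)
    case 0
    then show ?case using pos[THEN less_imp_neq, symmetric] by simp
  next
    case (Suc b)
    have "(\<lambda>n. ?M (Suc (n + b)) / ?M (n + b)) \<longlonglongrightarrow> 1 + m"
      using LIMSEQ_ignore_initial_segment[OF mean_pop_size_ratio, of b] by simp
    then have "(\<lambda>n. ?M n / ?M (n + b) / (?M (Suc (n + b)) / ?M (n + b))) \<longlonglongrightarrow> (1 / (1 + m)) ^ b / (1 + m)"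
      using m_pos by (intro tendsto_divide Suc) auto
    moreover have "?M n / ?M (n + b) / (?M (Suc (n + b)) / ?M (n + b)) = ?M n / ?M (n + Suc b)" for n
      using pos[of "n + b"] by simp
    ultimately have "(\<lambda>n. ?M n / ?M (n + Suc b)) \<longlonglongrightarrow> (1 / (1 + m)) ^ b / (1 + m)"
      by (simp only:)
    then show ?case by simp
  qed
  have e0: "(\<lambda>n. e n / ?M n) \<longlonglongrightarrow> 0"
  proof -
    obtain c where c: "c > 0" "\<forall>\<^sub>F n in sequentially. c * \<rho> ^ n \<le> ?M n"
      using eventually_mean_pop_size_ge by blast
    have "(\<lambda>n. \<bar>e n\<bar> / \<rho> ^ n / c) \<longlonglongrightarrow> 0"
      using summable_LIMSEQ_zero[OF s] by (rule tendsto_divide_zero)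
    moreover have "\<forall>\<^sub>F n in sequentially. norm (e n / ?M n) \<le> \<bar>e n\<bar> / \<rho> ^ n / c"
      using c(2)
    proof eventually_elim
      case (elim n)
      have "norm (e n / ?M n) = \<bar>e n\<bar> / ?M n" using pos[of n] by (simp add: abs_of_pos)
      also have "\<dots> \<le> \<bar>e n\<bar> / (c * \<rho> ^ n)"
        using elim c(1) \<rho> pos[of n] by (intro divide_left_mono) auto
      finally show ?case by (simp add: mult.commute)
    qed
    ultimately show ?thesis by (rule Lim_null_comparison[rotated])
  qed
  have "(\<lambda>n. m * (pop_size a X n / ?M n) * (?M n / ?M (n + 1)) + e (Suc n) / ?M (Suc n))
      \<longlonglongrightarrow> m * W * (1 / (1 + m)) ^ 1 + 0"
    by (intro tendsto_add tendsto_mult tendsto_const W lag LIMSEQ_Suc[OF e0])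
  moreover have "m * (pop_size a X n / ?M n) * (?M n / ?M (n + 1)) + e (Suc n) / ?M (Suc n)
      = X (Suc n) 0 / ?M (Suc n)" for n
    using pos[of n] pos[of "Suc n"] lin by (simp add: linear_aging_def add_divide_distrib)
  ultimately have "(\<lambda>n. X (Suc n) 0 / ?M (Suc n)) \<longlonglongrightarrow> m * W / (1 + m)" by simp
  then have births: "(\<lambda>n. X n 0 / ?M n) \<longlonglongrightarrow> m * W / (1 + m)" by (rule LIMSEQ_imp_Suc)
  have "(\<lambda>n. X n 0 / ?M n * (?M n / ?M (n + b)) / (pop_size a X (n + b) / ?M (n + b)))
      \<longlonglongrightarrow> m * W / (1 + m) * (1 / (1 + m)) ^ b / W"
    using W by (intro tendsto_divide tendsto_mult births lag LIMSEQ_ignore_initial_segment[OF W(1)]) auto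
  also have "m * W / (1 + m) * (1 / (1 + m)) ^ b / W = m / (m + 1) ^ (b + 1)"
    using W(2) by (simp add: power_one_over add.commute)
  finally have "(\<lambda>n. X n 0 / pop_size a X (n + b)) \<longlonglongrightarrow> m / (m + 1) ^ (b + 1)"
    using pos[THEN less_imp_neq, symmetric] by simp
  moreover have "\<forall>\<^sub>F n in sequentially. X n 0 / pop_size a X (n + b) = X (n + b) b / pop_size a X (n + b)"
  proof -
    have "\<forall>\<^sub>F n in sequentially. b \<le> a n"
      using a_lim by (simp add: filterlim_at_top)
    then show ?thesis
    proof eventually_elim
      case (elim n)
      then have "b \<le> a (n + b)" using a_mono[of n "n + b"] by simp
      then show ?case using living_is_birth[OF lin, of b "n + b"] by simp
    qed
  qed
  ultimately have "(\<lambda>n. X (n + b) b / pop_size a X (n + b)) \<longlonglongrightarrow> m / (m + 1) ^ (b + 1)"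
    by (rule Lim_transform_eventually)
  then show ?thesis by (rule LIMSEQ_offset)
qed

end

section \<open>Sums of independent counts\<close>

lemma measurable_nat_add:
  fixes f g :: "'a \<Rightarrow> nat"
  assumes f: "f \<in> measurable N (count_space UNIV)" and g: "g \<in> measurable N (count_space UNIV)"
  shows "(\<lambda>\<omega>. f \<omega> + g \<omega>) \<in> measurable N (count_space UNIV)"
  by (rule measurable_compose_countable[OF measurable_compose[OF g] f]) simp

lemma measurable_nat_sum:
  fixes f :: "'i \<Rightarrow> 'a \<Rightarrow> nat"
  assumes "\<And>i. i \<in> J \<Longrightarrow> f i \<in> measurable N (count_space UNIV)"
  shows "(\<lambda>\<omega>. \<Sum>i\<in>J. f i \<omega>) \<in> measurable N (count_space UNIV)"
  using assms by (induction J rule: infinite_finite_induct) (auto intro: measurable_nat_add)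

text \<open>
  Markov's inequality for \<open>(1 / 2)\<close> to the power of the sum: by independence its expectation is a
  product, in which each factor is at most \<open>1 - p / 2\<close>.
\<close>
lemma (in prob_space) prob_sum_less_le:
  fixes Y :: "'i \<Rightarrow> 'a \<Rightarrow> nat" and p :: real
  assumes J: "finite J" and indep: "indep_vars (\<lambda>_. count_space UNIV) Y J"
    and p: "\<And>j. j \<in> J \<Longrightarrow> p \<le> prob {\<omega> \<in> space M. 1 \<le> Y j \<omega>}"
  shows "prob {\<omega> \<in> space M. (\<Sum>j\<in>J. Y j \<omega>) < L} \<le> 2 ^ L * (1 - p / 2) ^ card J"
proof -
  define h :: "nat \<Rightarrow> real" where "h y = (if 1 \<le> y then 1 / 2 else 1)" for y
  have Ym[measurable]: "\<And>j. j \<in> J \<Longrightarrow> Y j \<in> measurable M (count_space UNIV)"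
    using indep by (auto simp: indep_vars_def)
  have int: "integrable M (\<lambda>\<omega>. h (Y j \<omega>))" if "j \<in> J" for j
    using Ym[OF that] by (intro integrable_const_bound[where B = 1]) (auto simp: h_def)
  have iv: "indep_vars (\<lambda>_. borel) (\<lambda>j \<omega>. h (Y j \<omega>)) J"
    using indep_vars_compose2[OF indep, of "\<lambda>_. h" "\<lambda>_. borel"] by simp
  have E: "expectation (\<lambda>\<omega>. h (Y j \<omega>)) \<le> 1 - p / 2" if "j \<in> J" for j
  proof -
    note [measurable] = Ym[OF that]
    define B where "B = {\<omega> \<in> space M. 1 \<le> Y j \<omega>}"
    have B: "B \<in> events" unfolding B_def by measurable
    have "integrable M (indicat_real B)"
      using B by (rule integrable_real_indicator) (simp add: emeasure_eq_measure)
    then have half: "integrable M (\<lambda>\<omega>. indicat_real B \<omega> / 2)"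
      by (rule integrable_divide_zero)
    have "expectation (\<lambda>\<omega>. h (Y j \<omega>)) = expectation (\<lambda>\<omega>. 1 - indicator B \<omega> / 2)"
      by (intro Bochner_Integration.integral_cong) (auto simp: h_def B_def indicator_def)
    also have "\<dots> = 1 - prob B / 2"
      using B half by (subst Bochner_Integration.integral_diff) (auto simp: prob_space)
    also have "\<dots> = 1 - prob {\<omega> \<in> space M. 1 \<le> Y j \<omega>} / 2" by (simp add: B_def)
    finally show ?thesis using p[OF that] by simp
  qed
  have "(1 / 2) ^ L * prob {\<omega> \<in> space M. (\<Sum>j\<in>J. Y j \<omega>) < L}
      = expectation (\<lambda>\<omega>. (1 / 2) ^ L * indicator {\<omega> \<in> space M. (\<Sum>j\<in>J. Y j \<omega>) < L} \<omega>)"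
    by simp
  also have "\<dots> \<le> expectation (\<lambda>\<omega>. \<Prod>j\<in>J. h (Y j \<omega>))"
  proof (rule integral_mono)
    have "{\<omega> \<in> space M. (\<Sum>j\<in>J. Y j \<omega>) < L} \<in> events"
      using measurable_nat_sum[of J Y M, OF Ym] by measurable
    from integrable_real_indicator[OF this] show "integrable M (\<lambda>\<omega>. (1 / 2) ^ L * indicator {\<omega> \<in> space M. (\<Sum>j\<in>J. Y j \<omega>) < L} \<omega> :: real)"
      by (simp add: emeasure_eq_measure)
    show "integrable M (\<lambda>\<omega>. \<Prod>j\<in>J. h (Y j \<omega>))"
      using indep_vars_integrable[OF J iv int] .
    fix \<omega> assume "\<omega> \<in> space M"
    show "(1 / 2) ^ L * indicator {\<omega> \<in> space M. (\<Sum>j\<in>J. Y j \<omega>) < L} \<omega> \<le> (\<Prod>j\<in>J. h (Y j \<omega>))"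
    proof (cases "(\<Sum>j\<in>J. Y j \<omega>) < L")
      case True
      have "(1 / 2 :: real) ^ L \<le> (1 / 2) ^ (\<Sum>j\<in>J. Y j \<omega>)"
        using True by (intro power_decreasing) auto
      also have "\<dots> = (\<Prod>j\<in>J. (1 / 2) ^ Y j \<omega>)"
        by (rule power_sum)
      also have "\<dots> \<le> (\<Prod>j\<in>J. h (Y j \<omega>))"
      proof (intro prod_mono conjI)
        fix j
        show "(1 / 2) ^ Y j \<omega> \<le> h (Y j \<omega>)"
          using power_decreasing[of 1 "Y j \<omega>" "1 / 2 :: real"] by (auto simp: h_def not_le)
      qed simp
      finally show ?thesis using \<open>\<omega> \<in> space M\<close> True by simp
    qed (auto intro: prod_nonneg simp: h_def)
  qed
  also have "\<dots> = (\<Prod>j\<in>J. expectation (\<lambda>\<omega>. h (Y j \<omega>)))"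
    by (rule indep_vars_lebesgue_integral[OF J iv int])
  also have "\<dots> \<le> (\<Prod>j\<in>J. 1 - p / 2)"
    using E by (intro prod_mono) (auto simp: h_def)
  finally show ?thesis by (simp add: power_one_over field_simps)
qed

section \<open>Litters that are independent of the past\<close>

locale branching_sources = prob_space M for M :: "'a measure" +
  fixes Z0 :: "nat \<Rightarrow> 'a \<Rightarrow> nat" and R :: "nat \<Rightarrow> nat \<Rightarrow> 'a \<Rightarrow> nat" and I :: "nat \<Rightarrow> 'a \<Rightarrow> nat"
    and law :: "nat pmf" and m :: real
  assumes Z0_meas: "\<And>b. Z0 b \<in> measurable M (count_space UNIV)"
    and R_meas: "\<And>j n. 1 \<le> j \<Longrightarrow> 1 \<le> n \<Longrightarrow> R j n \<in> measurable M (count_space UNIV)"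
    and R_distr: "\<And>j n. 1 \<le> j \<Longrightarrow> 1 \<le> n \<Longrightarrow> distr M (count_space UNIV) (R j n) = measure_pmf law"
    and I_meas: "\<And>n. 1 \<le> n \<Longrightarrow> I n \<in> measurable M (count_space UNIV)"
    and indep: "indep_sources Z0 R I"
    and law_square: "integrable (measure_pmf law) (\<lambda>k. (real k)\<^sup>2)"
    and m_def: "m = measure_pmf.expectation law real"
begin

definition info :: "source \<Rightarrow> 'a set set" where
  "info s = (case s of
     Initial \<Rightarrow> sets (vimage_algebra (space M) (\<lambda>\<omega> a. Z0 a \<omega>) (\<Pi>\<^sub>M a\<in>UNIV. count_space UNIV))
   | Offspring j n \<Rightarrow> sets (vimage_algebra (space M) (R j n) (count_space UNIV))
   | Immigration n \<Rightarrow> sets (vimage_algebra (space M) (I n) (count_space UNIV)))"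

definition sources :: "source set" where
  "sources = {Initial} \<union> {Offspring j n | j n. j \<ge> 1 \<and> n \<ge> 1} \<union> {Immigration n | n. n \<ge> 1}"

definition past :: "nat \<Rightarrow> source set" where
  "past n = {Initial} \<union> {Offspring j k | j k. j \<ge> 1 \<and> 1 \<le> k \<and> k \<le> n} \<union> {Immigration k | k. 1 \<le> k \<and> k \<le> n}"

definition litters :: "nat \<Rightarrow> source set" where
  "litters n = {Offspring j n | j. j \<ge> 1}"

text \<open>
  A measure space rather than a set of sets, so that measurability with respect to the
  information in a set of sources can be stated. The sets \<open>past n\<close> give the natural filtration.
\<close>
definition F :: "source set \<Rightarrow> 'a measure" where
  "F S = sigma (space M) (\<Union>s\<in>S. info s)"

lemma indep_info: "indep_sets info sources"
  using indep by (simp add: indep_sources_def info_def[abs_def] sources_def)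

lemma info_events: "s \<in> sources \<Longrightarrow> info s \<subseteq> events"
  using indep_info by (auto simp: indep_sets_def)

lemma info_sigma: "sigma_algebra (space M) (info s)"
  unfolding info_def
  by (cases s) (auto intro: sets.sigma_algebra_axioms[of "vimage_algebra (space M) f N" for f N, simplified])

lemma past_subset: "past n \<subseteq> sources"
  by (auto simp: past_def sources_def)

lemma past_mono: "i \<le> n \<Longrightarrow> past i \<subseteq> past n"
  by (auto simp: past_def)

lemma litters_subset: "1 \<le> n \<Longrightarrow> litters n \<subseteq> sources"
  by (auto simp: litters_def sources_def)

lemma space_F[simp]: "space (F S) = space M"
  by (simp add: F_def space_measure_of_conv)

lemma info_subset_Pow: "(\<Union>s\<in>S. info s) \<subseteq> Pow (space M)"
proof -
  have "info s \<subseteq> Pow (space M)" for s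
  proof -
    interpret sigma_algebra "space M" "info s" by (rule info_sigma)
    show ?thesis by (rule space_closed)
  qed
  then show ?thesis by blast
qed

lemma sets_F: "sets (F S) = sigma_sets (space M) (\<Union>s\<in>S. info s)"
  unfolding F_def by (rule sets_measure_of[OF info_subset_Pow])

lemma F_subalgebra:
  assumes "S \<subseteq> sources"
  shows "subalgebra M (F S)"
  unfolding subalgebra_def
proof
  have "(\<Union>s\<in>S. info s) \<subseteq> events" using assms info_events by blast
  then show "sets (F S) \<subseteq> sets M"
    unfolding sets_F by (rule sets.sigma_sets_subset)
qed simp

lemma measurable_F_mono:
  assumes "S \<subseteq> T" "f \<in> measurable (F S) N"
  shows "f \<in> measurable (F T) N"
proof -
  have "sets (F S) \<subseteq> sets (F T)"
    unfolding sets_F using assms(1) by (intro sigma_sets_mono') auto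
  then have "subalgebra (F T) (F S)" by (simp add: subalgebra_def)
  then show ?thesis using assms(2) by (rule measurable_from_subalg)
qed

lemma measurable_F_M: "S \<subseteq> sources \<Longrightarrow> f \<in> measurable (F S) N \<Longrightarrow> f \<in> measurable M N"
  by (rule measurable_from_subalg[OF F_subalgebra])

lemma measurable_info_F:
  assumes s: "s \<in> S" and f: "f \<in> measurable (vimage_algebra (space M) g K) N"
    and info: "info s = sets (vimage_algebra (space M) g K)"
  shows "f \<in> measurable (F S) N"
proof -
  have "info s \<subseteq> sets (F S)" unfolding sets_F using s by auto
  then have "subalgebra (F S) (vimage_algebra (space M) g K)"
    by (simp add: subalgebra_def info)
  then show ?thesis using f by (rule measurable_from_subalg)
qed

lemma Z0_F: "Initial \<in> S \<Longrightarrow> Z0 b \<in> measurable (F S) (count_space UNIV)"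
proof (rule measurable_info_F[of Initial])
  show "info Initial = sets (vimage_algebra (space M) (\<lambda>\<omega> a. Z0 a \<omega>) (\<Pi>\<^sub>M a\<in>UNIV. count_space UNIV))"
    by (simp add: info_def)
  have "(\<lambda>\<omega> a. Z0 a \<omega>) \<in> measurable (vimage_algebra (space M) (\<lambda>\<omega> a. Z0 a \<omega>)
      (\<Pi>\<^sub>M a\<in>UNIV. count_space UNIV)) (\<Pi>\<^sub>M a\<in>UNIV. count_space UNIV)"
    by (rule measurable_vimage_algebra1) (auto simp: space_PiM)
  from measurable_compose[OF this measurable_component_singleton[of b]]
  show "Z0 b \<in> measurable (vimage_algebra (space M) (\<lambda>\<omega> a. Z0 a \<omega>)
      (\<Pi>\<^sub>M a\<in>UNIV. count_space UNIV)) (count_space UNIV)"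
    by simp
qed

lemma R_F: "Offspring j n \<in> S \<Longrightarrow> R j n \<in> measurable (F S) (count_space UNIV)"
  by (rule measurable_info_F[of "Offspring j n"]) (auto simp: info_def intro: measurable_vimage_algebra1)

lemma I_F: "Immigration n \<in> S \<Longrightarrow> I n \<in> measurable (F S) (count_space UNIV)"
  by (rule measurable_info_F[of "Immigration n"]) (auto simp: info_def intro: measurable_vimage_algebra1)

lemma indep_F:
  assumes sub: "\<And>j. j \<in> J \<Longrightarrow> S j \<subseteq> sources" and disj: "disjoint_family_on S J"
  shows "indep_sets (\<lambda>j. sets (F (S j))) J"
  unfolding sets_F
proof (rule indep_sets_collect_sigma[OF _ _ disj])
  show "indep_sets info (\<Union>j\<in>J. S j)"
    using sub by (intro indep_sets_mono_index[OF _ indep_info]) auto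
  show "Int_stable (info s)" for s
  proof -
    interpret sigma_algebra "space M" "info s" by (rule info_sigma)
    show ?thesis by (rule Int_stable)
  qed
qed

lemma indep_vars_F:
  assumes sub: "\<And>j. j \<in> J \<Longrightarrow> S j \<subseteq> sources" and disj: "disjoint_family_on S J"
    and X: "\<And>j. j \<in> J \<Longrightarrow> X j \<in> measurable (F (S j)) (N j)"
  shows "indep_vars N X J"
  unfolding indep_vars_def2
proof
  show "\<forall>j\<in>J. random_variable (N j) (X j)"
    using measurable_F_M sub X by blast
  show "indep_sets (\<lambda>i. {X i -` A \<inter> space M |A. A \<in> sets (N i)}) J"
  proof (rule indep_sets_mono_sets[OF indep_F[OF sub disj]])
    fix j assume "j \<in> J"
    then show "{X j -` A \<inter> space M |A. A \<in> sets (N j)} \<subseteq> sets (F (S j))"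
      using measurable_sets[OF X] by auto
  qed
qed

lemma nn_integral_indicator_past_mult:
  assumes A: "A \<in> sets (F (past n))" and G: "G \<in> borel_measurable (F (litters (Suc n)))"
  shows "(\<integral>\<^sup>+\<omega>. indicator A \<omega> * G \<omega> \<partial>M) = emeasure M A * (\<integral>\<^sup>+\<omega>. G \<omega> \<partial>M)"
proof -
  let ?X = "case_bool (indicator A) G :: bool \<Rightarrow> 'a \<Rightarrow> ennreal"
    and ?S = "case_bool (past n) (litters (Suc n))"
  have "indep_vars (\<lambda>_. borel) ?X UNIV"
  proof (rule indep_vars_F[where S = ?S])
    show "?S j \<subseteq> sources" for j
      using past_subset litters_subset[of "Suc n"] by (cases j) auto
    show "disjoint_family_on ?S UNIV"
      by (auto simp: disjoint_family_on_def past_def litters_def split: bool.splits)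
    show "?X j \<in> borel_measurable (F (?S j))" for j
      using A G by (cases j) auto
  qed
  then have "(\<integral>\<^sup>+\<omega>. (\<Prod>i\<in>UNIV. ?X i \<omega>) \<partial>M) = (\<Prod>i\<in>UNIV. \<integral>\<^sup>+\<omega>. ?X i \<omega> \<partial>M)"
    by (intro indep_vars_nn_integral) auto
  moreover have "A \<in> events"
    using A F_subalgebra[OF past_subset] by (auto simp: subalgebra_def)
  ultimately show ?thesis by (simp add: UNIV_bool mult.commute)
qed

text \<open>
  An identity of Wald type: \<open>G z\<close> is a functional of \<open>z\<close> litters of the next generation whose mean
  is proportional to \<open>z\<close>. As the number \<open>V\<close> of parents is determined by the past, one may
  condition on its value. Both the mean number of children and the variance of the
  litters are of this kind.
\<close>
lemma nn_integral_random_litters: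
  fixes V :: "'a \<Rightarrow> nat" and G :: "nat \<Rightarrow> 'a \<Rightarrow> ennreal"
  assumes V: "V \<in> measurable (F (past n)) (count_space UNIV)"
    and G: "\<And>z. G z \<in> borel_measurable (F (litters (Suc n)))"
    and c: "\<And>z. (\<integral>\<^sup>+\<omega>. G z \<omega> \<partial>M) = of_nat z * c"
  shows "(\<integral>\<^sup>+\<omega>. G (V \<omega>) \<omega> \<partial>M) = c * (\<integral>\<^sup>+\<omega>. of_nat (V \<omega>) \<partial>M)"
proof -
  define A where "A z = V -` {z} \<inter> space M" for z
  have A: "A z \<in> sets (F (past n))" for z
    unfolding A_def using measurable_sets[OF V, of "{z}"] by simp
  then have A'[measurable]: "A z \<in> events" for z
    using F_subalgebra[OF past_subset] by (auto simp: subalgebra_def)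
  have [measurable]: "G z \<in> borel_measurable M" for z
    using litters_subset G by (intro measurable_F_M[of "litters (Suc n)"]) auto
  have split: "H (V \<omega>) \<omega> = (\<Sum>z. indicator (A z) \<omega> * H z \<omega>)"
    if "\<omega> \<in> space M" for \<omega> and H :: "nat \<Rightarrow> 'a \<Rightarrow> ennreal"
    using that by (subst suminf_finite[of "{V \<omega>}"]) (auto simp: A_def)
  have "(\<integral>\<^sup>+\<omega>. G (V \<omega>) \<omega> \<partial>M) = (\<integral>\<^sup>+\<omega>. (\<Sum>z. indicator (A z) \<omega> * G z \<omega>) \<partial>M)"
    by (intro nn_integral_cong split)
  also have "\<dots> = (\<Sum>z. \<integral>\<^sup>+\<omega>. indicator (A z) \<omega> * G z \<omega> \<partial>M)"
    by (intro nn_integral_suminf) measurable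
  also have "\<dots> = (\<Sum>z. c * (\<integral>\<^sup>+\<omega>. indicator (A z) \<omega> * of_nat z \<partial>M))"
    using nn_integral_indicator_past_mult[OF A G] c
    by (intro suminf_cong) (simp add: nn_integral_cmult_indicator mult_ac)
  also have "\<dots> = c * (\<Sum>z. \<integral>\<^sup>+\<omega>. indicator (A z) \<omega> * of_nat z \<partial>M)"
    by (rule ennreal_suminf_cmult)
  also have "(\<Sum>z. \<integral>\<^sup>+\<omega>. indicator (A z) \<omega> * of_nat z \<partial>M) = (\<integral>\<^sup>+\<omega>. (\<Sum>z. indicator (A z) \<omega> * of_nat z) \<partial>M)"
    by (intro nn_integral_suminf[symmetric]) measurable
  also have "\<dots> = (\<integral>\<^sup>+\<omega>. of_nat (V \<omega>) \<partial>M)"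
    by (intro nn_integral_cong) (rule split[symmetric])
  finally show ?thesis .
qed

definition law_var :: real where "law_var = measure_pmf.expectation law (\<lambda>k. (real k - m)\<^sup>2)"

lemma law_integrable:
  "integrable (measure_pmf law) real" "integrable (measure_pmf law) (\<lambda>k. (real k - m)\<^sup>2)"
proof -
  show 1: "integrable (measure_pmf law) real"
    using law_square by (rule Bochner_Integration.integrable_bound)
      (auto intro!: AE_I2 simp: power2_eq_square, metis le_square of_nat_le_iff of_nat_mult)
  have "(\<lambda>k. (real k - m)\<^sup>2) = (\<lambda>k. (real k)\<^sup>2 - 2 * m * real k + m\<^sup>2)"
    by (auto simp: power2_eq_square algebra_simps)
  then show "integrable (measure_pmf law) (\<lambda>k. (real k - m)\<^sup>2)"
    using 1 law_square by simp
qed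

lemma R_moments:
  assumes "1 \<le> j" "1 \<le> n"
  shows "integrable M (\<lambda>\<omega>. real (R j n \<omega>))" "expectation (\<lambda>\<omega>. real (R j n \<omega>)) = m"
    "integrable M (\<lambda>\<omega>. (real (R j n \<omega>) - m)\<^sup>2)" "expectation (\<lambda>\<omega>. (real (R j n \<omega>) - m)\<^sup>2) = law_var"
proof -
  note [measurable] = R_meas[OF assms]
  have i: "integrable M (\<lambda>\<omega>. f (R j n \<omega>))" if "integrable (measure_pmf law) f" for f :: "nat \<Rightarrow> real"
    using that integrable_distr_eq[of "R j n" M "count_space UNIV" f] by (simp add: R_distr[OF assms])
  have e: "expectation (\<lambda>\<omega>. f (R j n \<omega>)) = measure_pmf.expectation law f" for f :: "nat \<Rightarrow> real"
    using integral_distr[of "R j n" M "count_space UNIV" f] by (simp add: R_distr[OF assms])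
  show "integrable M (\<lambda>\<omega>. real (R j n \<omega>))" "expectation (\<lambda>\<omega>. real (R j n \<omega>)) = m"
    using i[OF law_integrable(1)] e[of real] by (auto simp: m_def)
  show "integrable M (\<lambda>\<omega>. (real (R j n \<omega>) - m)\<^sup>2)" "expectation (\<lambda>\<omega>. (real (R j n \<omega>) - m)\<^sup>2) = law_var"
    using i[OF law_integrable(2)] e[of "\<lambda>k. (real k - m)\<^sup>2"] by (auto simp: law_var_def)
qed

lemma law_var_nonneg: "0 \<le> law_var"
  by (simp add: law_var_def)

lemma m_nonneg: "0 \<le> m"
  by (simp add: m_def)

lemma litter_covariance:
  assumes "1 \<le> i" "1 \<le> j" "1 \<le> n" "i \<noteq> j"
  shows "integrable M (\<lambda>\<omega>. (real (R i n \<omega>) - m) * (real (R j n \<omega>) - m))"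
    and "expectation (\<lambda>\<omega>. (real (R i n \<omega>) - m) * (real (R j n \<omega>) - m)) = 0"
proof -
  let ?X = "\<lambda>j \<omega>. real (R j n \<omega>) - m"
  have iv: "indep_vars (\<lambda>_. borel) ?X {i, j}"
  proof (rule indep_vars_F[where S = "\<lambda>j. {Offspring j n}"])
    fix k assume "k \<in> {i, j}"
    then show "{Offspring k n} \<subseteq> sources" using assms by (auto simp: sources_def)
    show "?X k \<in> borel_measurable (F {Offspring k n})"
      using measurable_compose[OF R_F[of k n "{Offspring k n}"], of "\<lambda>x. real x - m" borel] by simp
  qed (auto simp: disjoint_family_on_def)
  have int: "integrable M (?X k)" if "k \<in> {i, j}" for k
    using that assms R_moments(1) by auto
  have z: "expectation (?X k) = 0" if "k \<in> {i, j}" for k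
    using that assms R_moments(1,2) by (auto simp: prob_space)
  show "integrable M (\<lambda>\<omega>. ?X i \<omega> * ?X j \<omega>)"
    using indep_vars_integrable[OF _ iv int] assms(4) by simp
  show "expectation (\<lambda>\<omega>. ?X i \<omega> * ?X j \<omega>) = 0"
    using indep_vars_lebesgue_integral[OF _ iv int] assms(4) z by simp
qed

text \<open>
  Only the diagonal survives when the square is expanded, since different litters are uncorrelated.
\<close>
lemma litter_variance:
  assumes n: "1 \<le> n"
  shows "(\<integral>\<^sup>+\<omega>. ennreal ((\<Sum>j=1..z. real (R j n \<omega>) - m)\<^sup>2) \<partial>M) = of_nat z * ennreal law_var"
proof -
  let ?X = "\<lambda>j \<omega>. real (R j n \<omega>) - m"
  have sq: "(\<Sum>j=1..z. ?X j \<omega>)\<^sup>2 = (\<Sum>i=1..z. \<Sum>j=1..z. ?X i \<omega> * ?X j \<omega>)" for \<omega>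
    by (simp add: power2_eq_square sum_product)
  have int: "integrable M (\<lambda>\<omega>. ?X i \<omega> * ?X j \<omega>)" if "i \<in> {1..z}" "j \<in> {1..z}" for i j
    using that n litter_covariance(1)[of i j n] R_moments(3)[of i n]
    by (cases "i = j") (auto simp: power2_eq_square)
  have E: "expectation (\<lambda>\<omega>. ?X i \<omega> * ?X j \<omega>) = (if j = i then law_var else 0)" if "i \<in> {1..z}" "j \<in> {1..z}" for i j
    using that n litter_covariance(2)[of i j n] R_moments(4)[of i n]
    by (cases "i = j") (auto simp: power2_eq_square)
  have "(\<integral>\<^sup>+\<omega>. ennreal ((\<Sum>j=1..z. ?X j \<omega>)\<^sup>2) \<partial>M) = ennreal (expectation (\<lambda>\<omega>. (\<Sum>j=1..z. ?X j \<omega>)\<^sup>2))"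
  proof (rule nn_integral_eq_integral)
    show "integrable M (\<lambda>\<omega>. (\<Sum>j=1..z. ?X j \<omega>)\<^sup>2)"
      unfolding sq using int by (intro Bochner_Integration.integrable_sum) auto
  qed simp
  also have "expectation (\<lambda>\<omega>. (\<Sum>j=1..z. ?X j \<omega>)\<^sup>2) = (\<Sum>i=1..z. \<Sum>j=1..z. expectation (\<lambda>\<omega>. ?X i \<omega> * ?X j \<omega>))"
    unfolding sq using int
    by (subst Bochner_Integration.integral_sum)
      (auto intro!: sum.cong Bochner_Integration.integral_sum Bochner_Integration.integrable_sum)
  also have "\<dots> = (\<Sum>i=1..z. \<Sum>j=1..z. if j = i then law_var else 0)"
    using E by (intro sum.cong) auto
  also have "\<dots> = real z * law_var" by simp
  finally show ?thesis using law_var_nonneg by (simp add: ennreal_mult ennreal_of_nat_eq_real_of_nat)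
qed

lemma litter_mean:
  assumes n: "1 \<le> n"
  shows "(\<integral>\<^sup>+\<omega>. of_nat (\<Sum>j=1..z. R j n \<omega>) \<partial>M) = of_nat z * ennreal m"
proof -
  have "(\<integral>\<^sup>+\<omega>. of_nat (\<Sum>j=1..z. R j n \<omega>) \<partial>M) = (\<integral>\<^sup>+\<omega>. ennreal (\<Sum>j=1..z. real (R j n \<omega>)) \<partial>M)"
    by (simp add: ennreal_of_nat_eq_real_of_nat)
  also have "\<dots> = ennreal (expectation (\<lambda>\<omega>. \<Sum>j=1..z. real (R j n \<omega>)))"
    using R_moments(1) n by (intro nn_integral_eq_integral Bochner_Integration.integrable_sum) (auto intro!: AE_I2 sum_nonneg)
  also have "expectation (\<lambda>\<omega>. \<Sum>j=1..z. real (R j n \<omega>)) = real z * m"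
    using R_moments(1,2) n by (subst Bochner_Integration.integral_sum) auto
  finally show ?thesis using m_nonneg by (simp add: ennreal_mult ennreal_of_nat_eq_real_of_nat)
qed

lemma sum_litters_F: "(\<lambda>\<omega>. \<Sum>j=1..z. R j n \<omega>) \<in> measurable (F (litters n)) (count_space UNIV)"
  by (intro measurable_nat_sum R_F) (auto simp: litters_def)

lemma noise_litters_F: "(\<lambda>\<omega>. \<Sum>j=1..z. real (R j n \<omega>) - m) \<in> borel_measurable (F (litters n))"
  by (intro borel_measurable_sum borel_measurable_diff measurable_compose[OF R_F] borel_measurable_const)
    (auto simp: litters_def)

lemma nn_integral_offspring:
  assumes "V \<in> measurable (F (past n)) (count_space UNIV)"
  shows "(\<integral>\<^sup>+\<omega>. of_nat (\<Sum>j=1..V \<omega>. R j (Suc n) \<omega>) \<partial>M) = ennreal m * (\<integral>\<^sup>+\<omega>. of_nat (V \<omega>) \<partial>M)"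
proof (rule nn_integral_random_litters[OF assms])
  fix z
  show "(\<lambda>\<omega>. of_nat (\<Sum>j=1..z. R j (Suc n) \<omega>) :: ennreal) \<in> borel_measurable (F (litters (Suc n)))"
    by (rule measurable_compose[OF sum_litters_F]) simp
  show "(\<integral>\<^sup>+\<omega>. of_nat (\<Sum>j=1..z. R j (Suc n) \<omega>) \<partial>M) = of_nat z * ennreal m"
    by (rule litter_mean) simp
qed

definition noise :: "('a \<Rightarrow> nat) \<Rightarrow> nat \<Rightarrow> 'a \<Rightarrow> real" where
  "noise V n \<omega> = (\<Sum>j=1..V \<omega>. real (R j n \<omega>) - m)"

lemma nn_integral_noise_square:
  assumes "V \<in> measurable (F (past n)) (count_space UNIV)"
  shows "(\<integral>\<^sup>+\<omega>. ennreal ((noise V (Suc n) \<omega>)\<^sup>2) \<partial>M) = ennreal law_var * (\<integral>\<^sup>+\<omega>. of_nat (V \<omega>) \<partial>M)"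
  unfolding noise_def
proof (rule nn_integral_random_litters[OF assms])
  fix z
  show "(\<lambda>\<omega>. ennreal ((\<Sum>j=1..z. real (R j (Suc n) \<omega>) - m)\<^sup>2)) \<in> borel_measurable (F (litters (Suc n)))"
    by (rule measurable_compose[OF noise_litters_F]) simp
  show "(\<integral>\<^sup>+\<omega>. ennreal ((\<Sum>j=1..z. real (R j (Suc n) \<omega>) - m)\<^sup>2) \<partial>M) = of_nat z * ennreal law_var"
    by (rule litter_variance) simp
qed

end

section \<open>Realizations as perturbed linear recursions\<close>

lemma pop_size_real_aging_bp:
  "pop_size a (\<lambda>n b. real (aging_bp a z0 r imm n b)) n = real (aging_bp_size a z0 r imm n)"
  by (simp add: pop_size_def aging_bp_size_def)

lemma linear_aging_bp:
  "linear_aging a m (\<lambda>n b. real (aging_bp a z0 r imm n b))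
     (\<lambda>n. (\<Sum>j=1..aging_bp_size a z0 r imm (n - 1). real (r j n) - m) + real (imm n))"
  by (simp add: linear_aging_def pop_size_def aging_bp_size_def sum_subtractf)

text \<open>
  Everybody draws a litter from the same array, and the parents of the smaller population use
  an initial segment of the litters used by the larger one, so the order is preserved pathwise,
  whatever immigrants arrive.
\<close>
lemma aging_bp_dominates_subpopulation:
  assumes "\<And>b. y0 b \<le> aging_bp a z0 r imm k b"
  shows "aging_bp (\<lambda>i. a (k + i)) y0 (\<lambda>j i. r j (k + i)) (\<lambda>_. 0) i b \<le> aging_bp a z0 r imm (k + i) b"
proof (induction i arbitrary: b)
  case (Suc i)
  have "(\<Sum>c\<le>a (k + i). aging_bp (\<lambda>i. a (k + i)) y0 (\<lambda>j i. r j (k + i)) (\<lambda>_. 0) i c)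
      \<le> (\<Sum>c\<le>a (k + i). aging_bp a z0 r imm (k + i) c)"
    by (rule sum_mono) (rule Suc)
  then show ?case
    using Suc by (auto intro!: trans_le_add1 sum_mono2)
qed (use assms in simp)

context aging
begin

lemma aging_bp_size_Suc_le:
  "aging_bp_size a z0 r imm (Suc n)
     \<le> aging_bp_size a z0 r imm n + (\<Sum>j=1..aging_bp_size a z0 r imm n. r j (Suc n)) + imm (Suc n)"
proof -
  let ?S = "aging_bp_size a z0 r imm"
  have "real (?S (Suc n)) \<le> (1 + m) * real (?S n) + ((\<Sum>j=1..?S n. real (r j (Suc n)) - m) + real (imm (Suc n)))"
    using pop_size_Suc[OF linear_aging_bp[of a m z0 r imm], of n]
    by (simp add: pop_size_real_aging_bp deaths_def)
  also have "\<dots> = real (?S n + (\<Sum>j=1..?S n. r j (Suc n)) + imm (Suc n))"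
    by (simp add: sum_subtractf algebra_simps)
  finally show ?thesis by (simp only: of_nat_le_iff)
qed

lemma recent_immigrants_le_size:
  assumes "l \<le> a k" "l \<le> k"
  shows "(\<Sum>i\<in>{k - l<..k}. imm i) \<le> aging_bp_size a z0 r imm k"
proof -
  let ?X = "aging_bp a z0 r imm"
  have "(\<Sum>i\<in>{k - l<..k}. imm i) = (\<Sum>b<l. imm (k - b))"
    using assms by (intro sum.reindex_bij_witness[of _ "\<lambda>b. k - b" "\<lambda>i. k - i"]) auto
  also have "\<dots> \<le> (\<Sum>b<l. ?X k b)"
  proof (rule sum_mono)
    fix b assume b: "b \<in> {..<l}"
    then have "real (?X k b) = real (?X (k - b) 0)"
      using living_is_birth[OF linear_aging_bp[of a m z0 r imm], of b k] assms by simp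
    moreover obtain i where "k - b = Suc i"
      using b assms by (cases "k - b") auto
    ultimately have "real (imm (k - b)) \<le> real (?X k b)" by (simp add: sum_nonneg)
    then show "imm (k - b) \<le> ?X k b" by (simp only: of_nat_le_iff)
  qed
  also have "\<dots> \<le> (\<Sum>b\<le>a k. ?X k b)"
    using assms by (intro sum_mono2) auto
  finally show ?thesis by (simp add: aging_bp_size_def)
qed

end

context branching_sources
begin

section \<open>Size of the noise and growth of the means\<close>

text \<open>
  By \<open>\<bar>y\<bar> \<le> (t + y\<^sup>2 / t) / 2\<close> the second moment controls the first absolute moment. Optimising over
  \<open>t\<close> gives the Cauchy-Schwarz bound.
\<close>
lemma nn_integral_abs_noise_le:
  assumes V: "V \<in> measurable (F (past n)) (count_space UNIV)"
    and x: "(\<integral>\<^sup>+\<omega>. of_nat (V \<omega>) \<partial>M) \<le> ennreal x" "0 \<le> x" and t: "0 < t"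
  shows "(\<integral>\<^sup>+\<omega>. ennreal \<bar>noise V (Suc n) \<omega>\<bar> \<partial>M) \<le> ennreal ((t + law_var * x / t) / 2)"
proof -
  have [measurable]: "(\<lambda>\<omega>. noise V (Suc n) \<omega>) \<in> borel_measurable M"
    unfolding noise_def
    by (rule measurable_compose_countable[OF measurable_F_M[OF litters_subset noise_litters_F]
          measurable_F_M[OF past_subset V]]) simp
  have le: "\<bar>y\<bar> \<le> t / 2 + 1 / (2 * t) * y\<^sup>2" for y :: real
  proof -
    have "0 \<le> (\<bar>y\<bar> - t)\<^sup>2 / (2 * t)" using t by simp
    also have "\<dots> = t / 2 + 1 / (2 * t) * y\<^sup>2 - \<bar>y\<bar>"
      using t by (simp add: power2_diff field_simps power2_eq_square)
    finally show ?thesis by simp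
  qed
  have "(\<integral>\<^sup>+\<omega>. ennreal \<bar>noise V (Suc n) \<omega>\<bar> \<partial>M)
      \<le> (\<integral>\<^sup>+\<omega>. ennreal (t / 2) + ennreal (1 / (2 * t)) * ennreal ((noise V (Suc n) \<omega>)\<^sup>2) \<partial>M)"
    using le t by (intro nn_integral_mono)
      (simp add: ennreal_mult[symmetric] ennreal_plus[symmetric] del: ennreal_plus)
  also have "\<dots> = ennreal (t / 2) + ennreal (1 / (2 * t)) * (ennreal law_var * (\<integral>\<^sup>+\<omega>. of_nat (V \<omega>) \<partial>M))"
    using nn_integral_noise_square[OF V]
    by (simp add: nn_integral_add nn_integral_cmult emeasure_space_1)
  also have "\<dots> \<le> ennreal (t / 2) + ennreal (1 / (2 * t)) * (ennreal law_var * ennreal x)"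
    using x by (intro add_left_mono mult_left_mono) auto
  also have "\<dots> = ennreal ((t + law_var * x / t) / 2)"
    using t x law_var_nonneg
    by (simp add: ennreal_mult[symmetric] ennreal_plus[symmetric] field_simps del: ennreal_plus)
  finally show ?thesis .
qed

text \<open>
  The noise in generation \<open>n\<close> is of order \<open>sqrt D * sqrt (1 + m) ^ n\<close>, so that dividing by
  \<open>\<rho> ^ n\<close> leaves a geometric series; the constant is its sum without the factor \<open>sqrt D\<close>.
\<close>
definition noise_const :: "real \<Rightarrow> real" where
  "noise_const \<rho> = (1 + law_var) / (2 * \<rho>) / (1 - sqrt (1 + m) / \<rho>)"

lemma nn_integral_noise_series_le:
  assumes \<rho>: "1 < \<rho>" "1 + m < \<rho>\<^sup>2" and D: "0 < D"
    and V: "\<And>n. V n \<in> measurable (F (past (k + n))) (count_space UNIV)"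
    and EV: "\<And>n. (\<integral>\<^sup>+\<omega>. of_nat (V n \<omega>) \<partial>M) \<le> ennreal (D * (1 + m) ^ n)"
  shows "(\<integral>\<^sup>+\<omega>. (\<Sum>n. ennreal (\<bar>noise (V n) (Suc (k + n)) \<omega>\<bar> / \<rho> ^ Suc n)) \<partial>M)
           \<le> ennreal (noise_const \<rho> * sqrt D)"
proof -
  define q where "q = sqrt (1 + m) / \<rho>"
  have "sqrt (1 + m) < \<rho>" using \<rho> by (intro real_less_lsqrt) auto
  then have q: "0 < q" "q < 1" using \<rho> m_nonneg by (auto simp: q_def add_pos_nonneg)
  define C where "C = (1 + law_var) / (2 * \<rho>) * sqrt D"
  have C: "0 \<le> C" using \<rho> D law_var_nonneg by (simp add: C_def)
  have meas[measurable]: "(\<lambda>\<omega>. noise (V n) (Suc (k + n)) \<omega>) \<in> borel_measurable M" for n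
    unfolding noise_def
    by (rule measurable_compose_countable[OF measurable_F_M[OF litters_subset noise_litters_F]
          measurable_F_M[OF past_subset V]]) simp
  have term_le: "(\<integral>\<^sup>+\<omega>. ennreal (\<bar>noise (V n) (Suc (k + n)) \<omega>\<bar> / \<rho> ^ Suc n) \<partial>M) \<le> ennreal (C * q ^ n)" for n
  proof -
    \<comment> \<open>This choice of \<open>t\<close> makes \<open>t\<close> and \<open>D * (1 + m) ^ n / t\<close> equal.\<close>
    define t where "t = sqrt (D * (1 + m) ^ n)"
    have "0 < D * (1 + m) ^ n" using D m_nonneg by simp
    then have t: "0 < t" "t * t = D * (1 + m) ^ n" "t = sqrt D * sqrt (1 + m) ^ n"
      by (simp_all only: t_def real_sqrt_gt_0_iff real_sqrt_mult_self abs_of_pos)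
        (simp add: real_sqrt_mult real_sqrt_power)
    have "(\<integral>\<^sup>+\<omega>. ennreal (\<bar>noise (V n) (Suc (k + n)) \<omega>\<bar> / \<rho> ^ Suc n) \<partial>M)
        = (\<integral>\<^sup>+\<omega>. ennreal (1 / \<rho> ^ Suc n) * ennreal \<bar>noise (V n) (Suc (k + n)) \<omega>\<bar> \<partial>M)"
      using \<rho> by (intro nn_integral_cong) (simp add: ennreal_mult[symmetric])
    also have "\<dots> = ennreal (1 / \<rho> ^ Suc n) * (\<integral>\<^sup>+\<omega>. ennreal \<bar>noise (V n) (Suc (k + n)) \<omega>\<bar> \<partial>M)"
      by (rule nn_integral_cmult) measurable
    also have "\<dots> \<le> ennreal (1 / \<rho> ^ Suc n) * ennreal ((t + law_var * (D * (1 + m) ^ n) / t) / 2)"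
      using D m_nonneg by (intro mult_left_mono nn_integral_abs_noise_le[OF V EV _ t(1)]) auto
    also have "\<dots> = ennreal (1 / \<rho> ^ Suc n * ((t + law_var * (D * (1 + m) ^ n) / t) / 2))"
      using D \<rho> m_nonneg law_var_nonneg t by (intro ennreal_mult[symmetric]) auto
    also have "law_var * (D * (1 + m) ^ n) / t = law_var * t"
      using t(1) by (simp add: t(2)[symmetric])
    also have "1 / \<rho> ^ Suc n * ((t + law_var * t) / 2) = C * q ^ n"
      using \<rho> by (simp add: C_def q_def t(3) power_divide field_simps)
    finally show ?thesis .
  qed
  have "(\<integral>\<^sup>+\<omega>. (\<Sum>n. ennreal (\<bar>noise (V n) (Suc (k + n)) \<omega>\<bar> / \<rho> ^ Suc n)) \<partial>M)
      = (\<Sum>n. \<integral>\<^sup>+\<omega>. ennreal (\<bar>noise (V n) (Suc (k + n)) \<omega>\<bar> / \<rho> ^ Suc n) \<partial>M)"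
    by (rule nn_integral_suminf) measurable
  also have "\<dots> \<le> (\<Sum>n. ennreal (C * q ^ n))"
    by (intro suminf_le term_le) auto
  also have "\<dots> = ennreal (C * (1 / (1 - q)))"
    using q C by (subst suminf_ennreal2) (auto intro!: summable_mult summable_geometric simp: suminf_mult suminf_geometric)
  also have "C * (1 / (1 - q)) = noise_const \<rho> * sqrt D"
    by (simp add: C_def noise_const_def q_def)
  finally show ?thesis .
qed

text \<open>
  The right-hand side dominates \<open>(B + d) * (1 + m) ^ n - d * r ^ n\<close> with \<open>d = c / (1 + m - r)\<close>,
  which solves the recursion \<open>f (n + 1) = (1 + m) * f n + c * r ^ n\<close> exactly.
\<close>
lemma nn_integral_growth_le:
  assumes V: "\<And>n. V n \<in> measurable (F (past (k + n))) (count_space UNIV)"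
    and J: "\<And>n. J n \<in> measurable M (count_space UNIV)"
    and rec: "\<And>n \<omega>. \<omega> \<in> space M \<Longrightarrow> V (Suc n) \<omega> \<le> V n \<omega> + (\<Sum>j=1..V n \<omega>. R j (Suc (k + n)) \<omega>) + J n \<omega>"
    and V0: "(\<integral>\<^sup>+\<omega>. of_nat (V 0 \<omega>) \<partial>M) \<le> ennreal B" "0 \<le> B"
    and EJ: "\<And>n. (\<integral>\<^sup>+\<omega>. of_nat (J n \<omega>) \<partial>M) \<le> ennreal (c * r ^ n)" "0 \<le> c" "0 < r" "r < 1 + m"
  shows "(\<integral>\<^sup>+\<omega>. of_nat (V n \<omega>) \<partial>M) \<le> ennreal ((B + c / (1 + m - r)) * (1 + m) ^ n)"
proof -
  define d where "d = c / (1 + m - r)"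
  have d: "0 \<le> d" "d * (1 + m - r) = c" using EJ by (auto simp: d_def)
  define f where "f n = (B + d) * (1 + m) ^ n - d * r ^ n" for n
  have f0: "0 \<le> f n" for n
  proof -
    have "d * r ^ n \<le> (B + d) * (1 + m) ^ n"
      using d(1) V0(2) EJ m_nonneg by (intro mult_mono power_mono) auto
    then show ?thesis by (simp add: f_def)
  qed
  have Vm: "V n \<in> measurable M (count_space UNIV)" for n
    by (rule measurable_F_M[OF past_subset V])
  have Om: "(\<lambda>\<omega>. \<Sum>j=1..V n \<omega>. R j (Suc (k + n)) \<omega>) \<in> measurable M (count_space UNIV)" for n
    by (rule measurable_compose_countable[OF measurable_F_M[OF litters_subset sum_litters_F] Vm]) simp
  have "(\<integral>\<^sup>+\<omega>. of_nat (V n \<omega>) \<partial>M) \<le> ennreal (f n)"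
  proof (induction n)
    case 0
    then show ?case using V0 by (simp add: f_def)
  next
    case (Suc n)
    define S where "S \<omega> = (\<Sum>j=1..V n \<omega>. R j (Suc (k + n)) \<omega>)" for \<omega>
    have [measurable]: "S \<in> measurable M (count_space UNIV)"
      using Om[of n] by (simp add: S_def[abs_def])
    note [measurable] = Vm[of n] J[of n]
    have ES: "(\<integral>\<^sup>+\<omega>. of_nat (S \<omega>) \<partial>M) = ennreal m * (\<integral>\<^sup>+\<omega>. of_nat (V n \<omega>) \<partial>M)"
      unfolding S_def by (rule nn_integral_offspring[OF V])
    have "(\<integral>\<^sup>+\<omega>. of_nat (V (Suc n) \<omega>) \<partial>M)
        \<le> (\<integral>\<^sup>+\<omega>. of_nat (V n \<omega>) + of_nat (S \<omega>) + of_nat (J n \<omega>) \<partial>M)"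
      unfolding of_nat_add[symmetric] S_def using rec by (intro nn_integral_mono of_nat_mono)
    also have "\<dots> = (\<integral>\<^sup>+\<omega>. of_nat (V n \<omega>) \<partial>M) + ennreal m * (\<integral>\<^sup>+\<omega>. of_nat (V n \<omega>) \<partial>M) + (\<integral>\<^sup>+\<omega>. of_nat (J n \<omega>) \<partial>M)"
      by (simp add: nn_integral_add ES)
    also have "\<dots> \<le> ennreal (f n) + ennreal m * ennreal (f n) + ennreal (c * r ^ n)"
      using Suc EJ(1)[of n] by (intro add_mono mult_left_mono) auto
    also have "\<dots> = ennreal (f n + m * f n + c * r ^ n)"
      using f0[of n] m_nonneg EJ by (simp add: ennreal_mult[symmetric] ennreal_plus[symmetric] del: ennreal_plus)
    also have "f n + m * f n + c * r ^ n = f (Suc n)"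
      by (simp add: f_def d(2)[symmetric] algebra_simps)
    finally show ?case .
  qed
  also have "f n \<le> (B + d) * (1 + m) ^ n"
    using d(1) EJ by (simp add: f_def)
  finally show ?thesis by (simp add: d_def ennreal_leI)
qed

lemma aging_bp_F:
  assumes z0: "\<And>b. z0 b \<in> measurable (F (past k)) (count_space UNIV)"
    and imm: "\<And>n. 1 \<le> n \<Longrightarrow> imm n \<in> measurable (F (past (k + n))) (count_space UNIV)"
  shows "(\<lambda>\<omega>. aging_bp a (\<lambda>b. z0 b \<omega>) (\<lambda>j n. R j (k + n) \<omega>) (\<lambda>n. imm n \<omega>) n b)
           \<in> measurable (F (past (k + n))) (count_space UNIV)"
proof (induction n arbitrary: b)
  case 0
  then show ?case using z0 by simp
next
  case (Suc n)
  let ?X = "\<lambda>n b \<omega>. aging_bp a (\<lambda>b. z0 b \<omega>) (\<lambda>j n. R j (k + n) \<omega>) (\<lambda>n. imm n \<omega>) n b"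
  have IH: "?X n b \<in> measurable (F (past (k + Suc n))) (count_space UNIV)" for b
    by (rule measurable_F_mono[OF past_mono Suc]) simp
  have size: "(\<lambda>\<omega>. \<Sum>c\<le>a n. ?X n c \<omega>) \<in> measurable (F (past (k + Suc n))) (count_space UNIV)"
    by (intro measurable_nat_sum IH)
  have "(\<lambda>\<omega>. \<Sum>j=1..(\<Sum>c\<le>a n. ?X n c \<omega>). R j (k + Suc n) \<omega>)
      \<in> measurable (F (past (k + Suc n))) (count_space UNIV)"
    by (rule measurable_compose_countable[OF _ size], intro measurable_nat_sum R_F) (auto simp: past_def)
  then have "(\<lambda>\<omega>. (\<Sum>j=1..(\<Sum>c\<le>a n. ?X n c \<omega>). R j (k + Suc n) \<omega>) + imm (Suc n) \<omega>)
      \<in> measurable (F (past (k + Suc n))) (count_space UNIV)"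
    using imm[of "Suc n"] by (intro measurable_nat_add) auto
  then show ?case
    using IH[of "b - 1"] by (cases "b = 0"; cases "b \<le> a (Suc n)") simp_all
qed

lemma aging_bp_size_F:
  assumes z0: "\<And>b. z0 b \<in> measurable (F (past k)) (count_space UNIV)"
    and imm: "\<And>n. 1 \<le> n \<Longrightarrow> imm n \<in> measurable (F (past (k + n))) (count_space UNIV)"
  shows "(\<lambda>\<omega>. aging_bp_size a (\<lambda>b. z0 b \<omega>) (\<lambda>j n. R j (k + n) \<omega>) (\<lambda>n. imm n \<omega>) n)
           \<in> measurable (F (past (k + n))) (count_space UNIV)"
  unfolding aging_bp_size_def by (intro measurable_nat_sum aging_bp_F[OF assms])

lemma mean_size_eq_mean_pop_size: "mean_size M a R n = mean_pop_size a m n"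
proof -
  let ?z = "\<lambda>b. if b = 0 then 1 else 0 :: nat"
  let ?X = "\<lambda>n b \<omega>. aging_bp a ?z (\<lambda>j n. R j n \<omega>) (\<lambda>_. 0) n b"
  have X: "?X n b \<in> measurable (F (past n)) (count_space UNIV)" for n b
    using aging_bp_F[of "\<lambda>b _. ?z b" 0 "\<lambda>_ _. 0" a n b] by simp
  have [measurable]: "?X n b \<in> measurable M (count_space UNIV)" for n b
    by (rule measurable_F_M[OF past_subset X])
  have mean0: "0 \<le> mean_pop a m n b" for n b
    using m_nonneg by (induction n arbitrary: b) (auto intro!: mult_nonneg_nonneg sum_nonneg)
  have EX: "(\<integral>\<^sup>+\<omega>. of_nat (?X n b \<omega>) \<partial>M) = ennreal (mean_pop a m n b)" for n b
  proof (induction n arbitrary: b)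
    case 0
    then show ?case by (simp add: emeasure_space_1)
  next
    case (Suc n)
    have V: "(\<lambda>\<omega>. \<Sum>c\<le>a n. ?X n c \<omega>) \<in> measurable (F (past n)) (count_space UNIV)"
      by (intro measurable_nat_sum X)
    have "(\<integral>\<^sup>+\<omega>. of_nat (\<Sum>c\<le>a n. ?X n c \<omega>) \<partial>M) = ennreal (\<Sum>c\<le>a n. mean_pop a m n c)"
      using Suc mean0 by (simp add: nn_integral_sum sum_ennreal)
    then have "(\<integral>\<^sup>+\<omega>. of_nat (?X (Suc n) 0 \<omega>) \<partial>M) = ennreal (mean_pop a m (Suc n) 0)"
      using nn_integral_offspring[OF V] m_nonneg mean0 by (simp add: ennreal_mult sum_nonneg del: of_nat_sum)
    then show ?case using Suc[of "b - 1"] by (cases "b = 0") auto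
  qed
  have size: "(\<lambda>\<omega>. real (aging_bp_size a ?z (\<lambda>j n. R j n \<omega>) (\<lambda>_. 0) n)) = (\<lambda>\<omega>. \<Sum>b\<le>a n. real (?X n b \<omega>))"
    by (simp add: aging_bp_size_def)
  have "(\<integral>\<^sup>+\<omega>. ennreal (\<Sum>b\<le>a n. real (?X n b \<omega>)) \<partial>M) = (\<integral>\<^sup>+\<omega>. (\<Sum>b\<le>a n. of_nat (?X n b \<omega>)) \<partial>M)"
    by (simp add: ennreal_of_nat_eq_real_of_nat sum_ennreal)
  also have "\<dots> = ennreal (mean_pop_size a m n)"
    using EX mean0 by (simp add: nn_integral_sum sum_ennreal pop_size_def)
  finally have "(\<integral>\<omega>. (\<Sum>b\<le>a n. real (?X n b \<omega>)) \<partial>M) = mean_pop_size a m n"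
    using mean0 by (intro integral_eq_nn_integral[THEN trans]) (auto intro!: sum_nonneg AE_I2 simp: pop_size_def sum_nonneg)
  then show ?thesis unfolding mean_size_def size .
qed

end

section \<open>Growth and tail conditions in geometric form\<close>

lemma eventually_le_power_if_limsup_log_less:
  fixes c :: "nat \<Rightarrow> ennreal" and g :: real
  assumes lim: "limsup (\<lambda>n. ln_ennreal (c n) / ereal (real n)) < ereal (ln g)" and g: "0 < g"
  shows "\<exists>r n0. 0 < r \<and> r < g \<and> (\<forall>n\<ge>n0. c n \<le> ennreal (r ^ n))"
proof -
  obtain z where z: "limsup (\<lambda>n. ln_ennreal (c n) / ereal (real n)) < ereal z" "ereal z < ereal (ln g)"
    using ereal_dense2[OF lim] by blast
  from Limsup_lessD[OF z(1)] obtain n0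
    where n0: "\<And>n. n \<ge> n0 \<Longrightarrow> ln_ennreal (c n) / ereal (real n) < ereal z"
    by (auto simp: eventually_sequentially)
  have "c n \<le> ennreal (exp z ^ n)" if n: "n \<ge> max n0 1" for n
  proof (cases "c n" rule: ennreal_cases)
    case top
    then show ?thesis using n0[of n] n by (simp add: ln_ennreal_def)
  next
    case (real x)
    show ?thesis
    proof (cases "x = 0")
      case False
      then have x: "0 < x" using real by simp
      then have "ereal (ln x) / ereal (real n) < ereal z"
        using n0[of n] n real by (simp add: ln_ennreal_def)
      then have "ln x < z * real n"
        using n by (simp add: pos_divide_less_eq)
      then have "x < exp (z * real n)"
        using x by (metis exp_ln exp_less_cancel_iff)
      also have "\<dots> = exp z ^ n"
        by (simp add: exp_of_nat2_mult)
      finally show ?thesis using real by (simp add: ennreal_leI)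
    qed (use real in simp)
  qed
  moreover have "exp z < g"
    using z(2) exp_less_mono[of z "ln g"] g by simp
  ultimately show ?thesis
    by (intro exI[of _ "exp z"] exI[of _ "max n0 1"]) auto
qed

lemma (in prob_space) uniformly_positive_tail:
  fixes X :: "'a \<Rightarrow> real"
  assumes X[measurable]: "X \<in> borel_measurable M" and pos: "0 < prob {\<omega> \<in> space M. X \<omega> > 0}"
  shows "\<exists>x>0. 0 < prob {\<omega> \<in> space M. X \<omega> \<ge> x}"
proof (rule ccontr)
  assume "\<not> ?thesis"
  then have "prob {\<omega> \<in> space M. X \<omega> \<ge> inverse (real (Suc n))} = 0" for n
    by (metis inverse_positive_iff_positive measure_nonneg of_nat_0_less_iff order_le_less zero_less_Suc)
  then have "AE \<omega> in M. \<not> X \<omega> \<ge> inverse (real (Suc n))" for n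
    by (subst AE_iff_measurable[OF _ refl]) (auto simp: emeasure_eq_measure)
  then have "AE \<omega> in M. \<forall>n. \<not> X \<omega> \<ge> inverse (real (Suc n))"
    by (simp add: AE_all_countable)
  then have "AE \<omega> in M. \<not> X \<omega> > 0"
  proof eventually_elim
    case (elim \<omega>)
    then show ?case using reals_Archimedean[of "X \<omega>"] by (meson less_imp_le)
  qed
  then have "prob {\<omega> \<in> space M. X \<omega> > 0} = 0"
    by (subst (asm) AE_iff_measurable[OF _ refl]) (auto simp: emeasure_eq_measure)
  then show False using pos by simp
qed

lemma AE_summable_of_nn_integral_suminf:
  fixes f :: "nat \<Rightarrow> 'a \<Rightarrow> real"
  assumes meas: "\<And>n. f n \<in> borel_measurable M" and nonneg: "\<And>n \<omega>. 0 \<le> f n \<omega>"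
    and fin: "(\<integral>\<^sup>+\<omega>. (\<Sum>n. ennreal (f n \<omega>)) \<partial>M) < \<infinity>"
  shows "AE \<omega> in M. summable (\<lambda>n. f n \<omega>)"
proof -
  have "(\<lambda>\<omega>. \<Sum>n. ennreal (f n \<omega>)) \<in> borel_measurable M"
    using meas by measurable
  then have "AE \<omega> in M. (\<Sum>n. ennreal (f n \<omega>)) \<noteq> \<infinity>"
    using fin by (intro nn_integral_PInf_AE) auto
  then show ?thesis
    by eventually_elim (rule summable_suminf_not_top[OF nonneg], simp)
qed

lemma exists_geometric_less:
  fixes q c \<epsilon> :: real
  assumes "0 \<le> q" "q < 1" "0 < \<epsilon>"
  shows "\<exists>n. c * q ^ n < \<epsilon>"
proof -
  have "(\<lambda>n. c * q ^ n) \<longlonglongrightarrow> c * 0"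
    using assms by (intro tendsto_mult tendsto_const LIMSEQ_realpow_zero) auto
  then have "\<forall>\<^sub>F n in sequentially. c * q ^ n < \<epsilon>"
    by (rule order_tendstoD(2)) (use assms in simp)
  then show ?thesis by (auto simp: eventually_sequentially)
qed

section \<open>The process with immigration\<close>

text \<open>
  The rate \<open>\<rho>\<close> lies between the order of the perturbation, given by \<open>sqrt (1 + m)\<close> for
  the litters and by \<open>r\<close> for the immigrants, and the growth factor \<open>1 + m\<close>. The bound on the mean
  immigration holds from generation \<open>n0\<close> on.
\<close>
locale immigration_process = branching_sources M Z0 R I law m + unbounded_aging a m \<rho>
  for M :: "'a measure" and Z0 R I law m a \<rho> +
  fixes r p :: real and n0 :: nat
  assumes noise_rate: "1 + m < \<rho>\<^sup>2"
    and r: "0 < r" "r < \<rho>"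
    and I_mean: "\<And>n. n0 \<le> n \<Longrightarrow> 1 \<le> n \<Longrightarrow> (\<integral>\<^sup>+\<omega>. of_nat (I n \<omega>) \<partial>M) \<le> ennreal (r ^ n)"
    and p: "0 < p" and I_prob: "\<And>n. 1 \<le> n \<Longrightarrow> p \<le> prob {\<omega> \<in> space M. 1 \<le> I n \<omega>}"
begin

definition X :: "nat \<Rightarrow> nat \<Rightarrow> 'a \<Rightarrow> nat" where
  "X n b \<omega> = aging_bp a (\<lambda>b. Z0 b \<omega>) (\<lambda>j k. R j k \<omega>) (\<lambda>k. I k \<omega>) n b"

definition Z :: "nat \<Rightarrow> 'a \<Rightarrow> nat" where
  "Z n \<omega> = aging_bp_size a (\<lambda>b. Z0 b \<omega>) (\<lambda>j k. R j k \<omega>) (\<lambda>k. I k \<omega>) n"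

definition perturbation :: "nat \<Rightarrow> 'a \<Rightarrow> real" where
  "perturbation n \<omega> = noise (Z (n - 1)) n \<omega> + real (I n \<omega>)"

lemma X_linear: "linear_aging a m (\<lambda>n b. real (X n b \<omega>)) (\<lambda>n. perturbation n \<omega>)"
  using linear_aging_bp[of a m "\<lambda>b. Z0 b \<omega>" "\<lambda>j k. R j k \<omega>" "\<lambda>k. I k \<omega>"]
  by (simp add: X_def Z_def perturbation_def noise_def)

lemma X_pop_size: "pop_size a (\<lambda>n b. real (X n b \<omega>)) n = real (Z n \<omega>)"
  by (simp add: X_def Z_def pop_size_real_aging_bp)

lemma X_F: "X n b \<in> measurable (F (past n)) (count_space UNIV)"
  unfolding X_def[abs_def]
  using aging_bp_F[of Z0 0 I a n b] Z0_F I_F by (simp add: past_def)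

lemma Z_F: "Z n \<in> measurable (F (past n)) (count_space UNIV)"
  unfolding Z_def[abs_def]
  using aging_bp_size_F[of Z0 0 I a n] Z0_F I_F by (simp add: past_def)

lemma X_meas[measurable]: "X n b \<in> measurable M (count_space UNIV)"
  by (rule measurable_F_M[OF past_subset X_F])

lemma Z_meas[measurable]: "Z n \<in> measurable M (count_space UNIV)"
  by (rule measurable_F_M[OF past_subset Z_F])

lemma noise_meas:
  "V \<in> measurable (F (past n)) (count_space UNIV) \<Longrightarrow> noise V (Suc n) \<in> borel_measurable M"
  unfolding noise_def[abs_def]
  by (rule measurable_compose_countable[OF measurable_F_M[OF litters_subset noise_litters_F]
        measurable_F_M[OF past_subset]]) simp_all

text \<open>
  The size in generation \<open>k\<close> may have an infinite mean, because of early immigrants. Restricting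
  to the event \<open>Z k \<le> B\<close>, which is known in all later generations, makes all means finite.
\<close>
lemma AE_noise_summable:
  assumes k: "n0 \<le> k"
  shows "AE \<omega> in M. Z k \<omega> \<le> B \<longrightarrow> summable (\<lambda>n. \<bar>noise (Z (k + n)) (Suc (k + n)) \<omega>\<bar> / \<rho> ^ Suc n)"
proof -
  define V where "V n \<omega> = (if Z k \<omega> \<le> B then Z (k + n) \<omega> else 0)" for n \<omega>
  have V: "V n \<in> measurable (F (past (k + n))) (count_space UNIV)" for n
  proof -
    note [measurable] = measurable_F_mono[OF past_mono[of k "k + n"] Z_F] Z_F[of "k + n"]
    show ?thesis unfolding V_def[abs_def] by measurable
  qed
  have EV: "(\<integral>\<^sup>+\<omega>. of_nat (V n \<omega>) \<partial>M) \<le> ennreal ((real B + r ^ Suc k / (1 + m - r)) * (1 + m) ^ n)" for n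
  proof (rule nn_integral_growth_le[OF V, where J = "\<lambda>n. I (Suc (k + n))"])
    show "I (Suc (k + n)) \<in> measurable M (count_space UNIV)" for n
      by (rule I_meas) simp
    show "V (Suc n) \<omega> \<le> V n \<omega> + (\<Sum>j=1..V n \<omega>. R j (Suc (k + n)) \<omega>) + I (Suc (k + n)) \<omega>" for n \<omega>
      using aging_bp_size_Suc_le[of "\<lambda>b. Z0 b \<omega>" "\<lambda>j k. R j k \<omega>" "\<lambda>k. I k \<omega>" "k + n"]
      by (simp add: V_def Z_def)
    have "(\<integral>\<^sup>+\<omega>. of_nat (V 0 \<omega>) \<partial>M) \<le> (\<integral>\<^sup>+\<omega>. of_nat B \<partial>M)"
      by (intro nn_integral_mono) (auto simp: V_def)
    then show "(\<integral>\<^sup>+\<omega>. of_nat (V 0 \<omega>) \<partial>M) \<le> ennreal (real B)"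
      by (simp add: emeasure_space_1 ennreal_of_nat_eq_real_of_nat)
    show "(\<integral>\<^sup>+\<omega>. of_nat (I (Suc (k + n)) \<omega>) \<partial>M) \<le> ennreal (r ^ Suc k * r ^ n)" for n
      using I_mean[of "Suc (k + n)"] k by (simp add: power_add mult.assoc)
  qed (use r \<rho> in auto)
  have D: "0 < real B + r ^ Suc k / (1 + m - r)"
    using r \<rho> by (intro add_nonneg_pos divide_pos_pos) auto
  have "AE \<omega> in M. summable (\<lambda>n. \<bar>noise (V n) (Suc (k + n)) \<omega>\<bar> / \<rho> ^ Suc n)"
  proof (rule AE_summable_of_nn_integral_suminf)
    show "(\<lambda>\<omega>. \<bar>noise (V n) (Suc (k + n)) \<omega>\<bar> / \<rho> ^ Suc n) \<in> borel_measurable M" for n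
      using noise_meas[OF V] by measurable
    show "(\<integral>\<^sup>+\<omega>. (\<Sum>n. ennreal (\<bar>noise (V n) (Suc (k + n)) \<omega>\<bar> / \<rho> ^ Suc n)) \<partial>M) < \<infinity>"
      using nn_integral_noise_series_le[OF \<rho>(1) noise_rate D V EV]
      by (rule le_less_trans) simp
  qed (use \<rho> in simp)
  then show ?thesis
    by eventually_elim (rule impI, simp add: V_def noise_def)
qed

lemma AE_immigration_summable:
  "AE \<omega> in M. summable (\<lambda>n. real (I (Suc (n0 + n)) \<omega>) / \<rho> ^ Suc (n0 + n))"
proof (rule AE_summable_of_nn_integral_suminf)
  show meas: "(\<lambda>\<omega>. real (I (Suc (n0 + n)) \<omega>) / \<rho> ^ Suc (n0 + n)) \<in> borel_measurable M" for n
    by (rule measurable_compose[OF I_meas]) simp_all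
  have "(\<integral>\<^sup>+\<omega>. (\<Sum>n. ennreal (real (I (Suc (n0 + n)) \<omega>) / \<rho> ^ Suc (n0 + n))) \<partial>M)
      = (\<Sum>n. \<integral>\<^sup>+\<omega>. ennreal (real (I (Suc (n0 + n)) \<omega>) / \<rho> ^ Suc (n0 + n)) \<partial>M)"
    by (intro nn_integral_suminf measurable_compose[OF meas measurable_ennreal])
  also have "\<dots> \<le> (\<Sum>n. ennreal ((r / \<rho>) ^ Suc (n0 + n)))"
  proof (intro suminf_le)
    fix n
    let ?n = "Suc (n0 + n)"
    have "(\<integral>\<^sup>+\<omega>. ennreal (real (I ?n \<omega>) / \<rho> ^ ?n) \<partial>M) = (\<integral>\<^sup>+\<omega>. ennreal (1 / \<rho> ^ ?n) * of_nat (I ?n \<omega>) \<partial>M)"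
      using \<rho> by (intro nn_integral_cong) (simp add: ennreal_of_nat_eq_real_of_nat ennreal_mult[symmetric])
    also have "\<dots> = ennreal (1 / \<rho> ^ ?n) * (\<integral>\<^sup>+\<omega>. of_nat (I ?n \<omega>) \<partial>M)"
      by (rule nn_integral_cmult, rule measurable_compose[OF I_meas]) simp_all
    also have "\<dots> \<le> ennreal (1 / \<rho> ^ ?n) * ennreal (r ^ ?n)"
      by (intro mult_left_mono I_mean) auto
    also have "\<dots> = ennreal ((r / \<rho>) ^ ?n)"
      using r \<rho> by (simp add: ennreal_mult[symmetric] power_divide)
    finally show "(\<integral>\<^sup>+\<omega>. ennreal (real (I ?n \<omega>) / \<rho> ^ ?n) \<partial>M) \<le> ennreal ((r / \<rho>) ^ ?n)" .
  qed auto
  also have "\<dots> < \<infinity>"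
  proof -
    have "summable (\<lambda>n. (r / \<rho>) ^ (n + Suc n0))"
      using r \<rho> by (intro summable_ignore_initial_segment summable_geometric) auto
    then have "summable (\<lambda>n. (r / \<rho>) ^ Suc (n0 + n))"
      by (simp add: add.commute)
    then show ?thesis
      using r \<rho> by (subst suminf_ennreal2) auto
  qed
  finally show "(\<integral>\<^sup>+\<omega>. (\<Sum>n. ennreal (real (I (Suc (n0 + n)) \<omega>) / \<rho> ^ Suc (n0 + n))) \<partial>M) < \<infinity>" .
qed (use \<rho> in simp)

lemma AE_perturbation_summable: "AE \<omega> in M. summable (\<lambda>n. \<bar>perturbation n \<omega>\<bar> / \<rho> ^ n)"
proof -
  have "AE \<omega> in M. \<forall>B. Z n0 \<omega> \<le> B \<longrightarrow> summable (\<lambda>n. \<bar>noise (Z (n0 + n)) (Suc (n0 + n)) \<omega>\<bar> / \<rho> ^ Suc n)"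
    unfolding AE_all_countable using AE_noise_summable[OF order_refl] by blast
  with AE_immigration_summable show ?thesis
  proof eventually_elim
    case (elim \<omega>)
    have "summable (\<lambda>n. \<bar>noise (Z (n0 + n)) (Suc (n0 + n)) \<omega>\<bar> / \<rho> ^ Suc n * (1 / \<rho> ^ n0)
        + real (I (Suc (n0 + n)) \<omega>) / \<rho> ^ Suc (n0 + n))"
      using elim by (intro summable_add summable_mult2) auto
    then have "summable (\<lambda>n. \<bar>perturbation (n + Suc n0) \<omega>\<bar> / \<rho> ^ (n + Suc n0))"
    proof (rule summable_comparison_test'[where N = 0])
      fix n
      have "\<bar>perturbation (Suc (n0 + n)) \<omega>\<bar> / \<rho> ^ Suc (n0 + n)
          \<le> (\<bar>noise (Z (n0 + n)) (Suc (n0 + n)) \<omega>\<bar> + real (I (Suc (n0 + n)) \<omega>)) / \<rho> ^ Suc (n0 + n)"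
        using \<rho> abs_triangle_ineq[of "noise (Z (n0 + n)) (Suc (n0 + n)) \<omega>" "real (I (Suc (n0 + n)) \<omega>)"]
        by (intro divide_right_mono) (auto simp: perturbation_def)
      also have "\<dots> = \<bar>noise (Z (n0 + n)) (Suc (n0 + n)) \<omega>\<bar> / \<rho> ^ Suc n * (1 / \<rho> ^ n0)
          + real (I (Suc (n0 + n)) \<omega>) / \<rho> ^ Suc (n0 + n)"
        using \<rho> by (simp add: add_divide_distrib power_add mult_ac)
      finally show "norm (\<bar>perturbation (n + Suc n0) \<omega>\<bar> / \<rho> ^ (n + Suc n0))
          \<le> \<bar>noise (Z (n0 + n)) (Suc (n0 + n)) \<omega>\<bar> / \<rho> ^ Suc n * (1 / \<rho> ^ n0)
            + real (I (Suc (n0 + n)) \<omega>) / \<rho> ^ Suc (n0 + n)"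
        using \<rho> by (simp add: add.commute)
    qed
    then show ?case by (rule summable_iff_shift[THEN iffD1])
  qed
qed

definition W :: "'a \<Rightarrow> real" where
  "W \<omega> = lim (\<lambda>n. real (Z n \<omega>) / mean_pop_size a m n)"

lemma W_meas[measurable]: "W \<in> borel_measurable M"
  unfolding W_def[abs_def] by (intro borel_measurable_lim_metric) measurable

lemma AE_tendsto_W: "AE \<omega> in M. (\<lambda>n. real (Z n \<omega>) / mean_pop_size a m n) \<longlonglongrightarrow> W \<omega>"
  using AE_perturbation_summable
proof eventually_elim
  case (elim \<omega>)
  then show ?case
    using pop_size_over_mean_convergent[OF X_linear elim]
    by (simp add: X_pop_size W_def convergent_LIMSEQ_iff)
qed

lemma offspring_prob_pos:
  "\<exists>q>0. \<forall>j n. 1 \<le> j \<longrightarrow> 1 \<le> n \<longrightarrow> q \<le> prob {\<omega> \<in> space M. 1 \<le> R j n \<omega>}"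
proof -
  define q where "q = measure (measure_pmf law) {1..}"
  have "q \<noteq> 0"
  proof
    assume "q = 0"
    then have "AE k in measure_pmf law. k \<notin> {1..}"
      by (subst AE_iff_measurable[OF _ refl]) (auto simp: q_def measure_pmf.emeasure_eq_measure atLeast_def)
    then have "measure_pmf.expectation law real = measure_pmf.expectation law (\<lambda>_. 0)"
      by (intro integral_cong_AE) (auto elim!: eventually_mono)
    then show False using m_def m_pos by simp
  qed
  then have "0 < q" by (simp add: q_def less_le)
  moreover have "prob {\<omega> \<in> space M. 1 \<le> R j n \<omega>} = q" if "1 \<le> j" "1 \<le> n" for j n
    using measure_distr[OF R_meas[OF that], of "{1..}"] R_distr[OF that]
    by (simp add: q_def vimage_def Int_def conj_commute)
  ultimately show ?thesis by (intro exI[of _ q]) auto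
qed

text \<open>
  Once the maximal age is at least \<open>l\<close>, the immigrants of the last \<open>l\<close> generations are all alive, so
  there are at least \<open>L'\<close> individuals with high probability, and \<open>L'\<close> litters rarely
  contain fewer than \<open>L\<close> children.
\<close>
lemma newborns_unbounded_in_probability:
  assumes \<epsilon>: "0 < \<epsilon>"
  shows "\<exists>k0. \<forall>k\<ge>k0. prob {\<omega> \<in> space M. X k 0 \<omega> < L} < \<epsilon>"
proof -
  obtain q where q: "0 < q" "\<And>j n. 1 \<le> j \<Longrightarrow> 1 \<le> n \<Longrightarrow> q \<le> prob {\<omega> \<in> space M. 1 \<le> R j n \<omega>}"
    using offspring_prob_pos by blast
  have q1: "q \<le> 1" "p \<le> 1"
    using q(2)[of 1 1] I_prob[of 1] prob_le_1 order_trans by auto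
  obtain L' where L': "2 ^ L * (1 - q / 2) ^ L' < \<epsilon> / 2"
    using exists_geometric_less[of "1 - q / 2" "\<epsilon> / 2" "2 ^ L"] q q1 \<epsilon> by auto
  obtain l where l: "2 ^ L' * (1 - p / 2) ^ l < \<epsilon> / 2"
    using exists_geometric_less[of "1 - p / 2" "\<epsilon> / 2" "2 ^ L'"] p q1 \<epsilon> by auto
  have "\<forall>\<^sub>F k in sequentially. l \<le> a k"
    using a_lim by (simp add: filterlim_at_top)
  then obtain k1 where k1: "\<And>k. k1 \<le> k \<Longrightarrow> l \<le> a k"
    by (auto simp: eventually_sequentially)
  have "prob {\<omega> \<in> space M. X (Suc k) 0 \<omega> < L} < \<epsilon>" if k: "max k1 l \<le> k" for k
  proof -
    let ?J = "{k - l<..k}"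
    have [measurable]: "(\<lambda>\<omega>. \<Sum>i\<in>?J. I i \<omega>) \<in> measurable M (count_space UNIV)"
      by (intro measurable_nat_sum I_meas) auto
    have [measurable]: "(\<lambda>\<omega>. \<Sum>j=1..L'. R j (Suc k) \<omega>) \<in> measurable M (count_space UNIV)"
      by (intro measurable_nat_sum R_meas) auto
    have "indep_vars (\<lambda>_. count_space UNIV) I ?J"
      by (rule indep_vars_F[where S = "\<lambda>i. {Immigration i}"])
        (auto simp: sources_def disjoint_family_on_def intro: I_F)
    then have "prob {\<omega> \<in> space M. (\<Sum>i\<in>?J. I i \<omega>) < L'} \<le> 2 ^ L' * (1 - p / 2) ^ card ?J"
      using I_prob by (intro prob_sum_less_le) auto
    also have "card ?J = l" using k by simp
    finally have few_imm: "prob {\<omega> \<in> space M. (\<Sum>i\<in>?J. I i \<omega>) < L'} < \<epsilon> / 2"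
      using l by linarith
    have "indep_vars (\<lambda>_. count_space UNIV) (\<lambda>j. R j (Suc k)) {1..L'}"
      by (rule indep_vars_F[where S = "\<lambda>j. {Offspring j (Suc k)}"])
        (auto simp: sources_def disjoint_family_on_def intro: R_F)
    then have "prob {\<omega> \<in> space M. (\<Sum>j=1..L'. R j (Suc k) \<omega>) < L} \<le> 2 ^ L * (1 - q / 2) ^ card {1..L'}"
      using q(2) by (intro prob_sum_less_le) auto
    then have few_off: "prob {\<omega> \<in> space M. (\<Sum>j=1..L'. R j (Suc k) \<omega>) < L} < \<epsilon> / 2"
      using L' by simp
    have "X (Suc k) 0 \<omega> \<ge> L" if imm: "(\<Sum>i\<in>?J. I i \<omega>) \<ge> L'" and off: "(\<Sum>j=1..L'. R j (Suc k) \<omega>) \<ge> L" for \<omega>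
    proof -
      have "L' \<le> Z k \<omega>"
        using recent_immigrants_le_size[of l k "\<lambda>i. I i \<omega>" "\<lambda>b. Z0 b \<omega>" "\<lambda>j k. R j k \<omega>"] k1[of k] k imm
        by (simp add: Z_def)
      then have "(\<Sum>j=1..L'. R j (Suc k) \<omega>) \<le> (\<Sum>j=1..Z k \<omega>. R j (Suc k) \<omega>)"
        by (intro sum_mono2) auto
      then show ?thesis using off by (simp add: X_def Z_def aging_bp_size_def)
    qed
    then have "prob {\<omega> \<in> space M. X (Suc k) 0 \<omega> < L}
        \<le> prob ({\<omega> \<in> space M. (\<Sum>i\<in>?J. I i \<omega>) < L'} \<union> {\<omega> \<in> space M. (\<Sum>j=1..L'. R j (Suc k) \<omega>) < L})"
    proof (intro finite_measure_mono)
      show "{\<omega> \<in> space M. (\<Sum>i\<in>?J. I i \<omega>) < L'} \<union> {\<omega> \<in> space M. (\<Sum>j=1..L'. R j (Suc k) \<omega>) < L} \<in> events"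
        by measurable
    qed (use not_le in blast)
    also have "\<dots> \<le> prob {\<omega> \<in> space M. (\<Sum>i\<in>?J. I i \<omega>) < L'} + prob {\<omega> \<in> space M. (\<Sum>j=1..L'. R j (Suc k) \<omega>) < L}"
      by (rule measure_Un_le) measurable
    finally show ?thesis using few_imm few_off by linarith
  qed
  then show ?thesis
    by (intro exI[of _ "Suc (max k1 l)"]) (metis Suc_le_D Suc_le_mono)
qed

text \<open>
  If generation \<open>k\<close> has at least \<open>L\<close> newborns, the process dominates the population without
  immigration that starts from \<open>L\<close> of them. Its normalised limit differs from \<open>L\<close> by at most a
  constant times the normalised noise, whose mean is of order \<open>sqrt L\<close>. By Markov's inequality
  the noise reaches the size \<open>L\<close> that is necessary for extinction only with
  probability of order \<open>1 / sqrt L\<close>, for all \<open>k\<close> alike.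
\<close>
lemma prob_not_surviving_le:
  assumes k: "slow_from k" and L: "0 < L"
  shows "prob {\<omega> \<in> space M. \<not> 0 < W \<omega>}
    \<le> prob {\<omega> \<in> space M. X k 0 \<omega> < L} + 2 / (1 - 1 / \<rho>) * noise_const \<rho> / sqrt (real L)"
proof -
  interpret S: slow_aging "\<lambda>i. a (k + i)" m \<rho> "1 / sqrt \<rho>" by (rule k)
  let ?z = "\<lambda>b. if b = 0 then L else 0 :: nat"
  define y where "y i b \<omega> = aging_bp (\<lambda>i. a (k + i)) ?z (\<lambda>j i. R j (k + i) \<omega>) (\<lambda>_. 0) i b" for i b \<omega>
  define Y where "Y i \<omega> = aging_bp_size (\<lambda>i. a (k + i)) ?z (\<lambda>j i. R j (k + i) \<omega>) (\<lambda>_. 0) i" for i \<omega>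
  define T where "T \<omega> = (\<Sum>n. ennreal (\<bar>noise (Y n) (Suc (k + n)) \<omega>\<bar> / \<rho> ^ Suc n))" for \<omega>
  define c where "c = 2 / (1 - 1 / \<rho>)"
  have c: "0 < c" using \<rho> by (simp add: c_def)
  have Y: "Y n \<in> measurable (F (past (k + n))) (count_space UNIV)" for n
    unfolding Y_def[abs_def] by (rule aging_bp_size_F) simp_all
  have EY: "(\<integral>\<^sup>+\<omega>. of_nat (Y n \<omega>) \<partial>M) \<le> ennreal (real L * (1 + m) ^ n)" for n
  proof -
    have "(\<integral>\<^sup>+\<omega>. of_nat (Y n \<omega>) \<partial>M) \<le> ennreal ((real L + 0 / (1 + m - r)) * (1 + m) ^ n)"
    proof (rule nn_integral_growth_le[OF Y, where J = "\<lambda>_ _. 0"])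
      show "Y (Suc n) \<omega> \<le> Y n \<omega> + (\<Sum>j=1..Y n \<omega>. R j (Suc (k + n)) \<omega>) + 0" for n \<omega>
        using S.aging_bp_size_Suc_le[of ?z "\<lambda>j i. R j (k + i) \<omega>" "\<lambda>_. 0" n] by (simp add: Y_def)
      show "(\<integral>\<^sup>+\<omega>. of_nat (Y 0 \<omega>) \<partial>M) \<le> ennreal (real L)"
        by (simp add: Y_def aging_bp_size_def emeasure_space_1 ennreal_of_nat_eq_real_of_nat)
    qed (use r \<rho> in auto)
    then show ?thesis by simp
  qed
  note [measurable] = noise_meas[OF Y]
  have T[measurable]: "T \<in> borel_measurable M"
    unfolding T_def[abs_def] by measurable
  have ET: "(\<integral>\<^sup>+\<omega>. T \<omega> \<partial>M) \<le> ennreal (noise_const \<rho> * sqrt (real L))"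
    unfolding T_def using L by (intro nn_integral_noise_series_le[OF \<rho>(1) noise_rate _ Y EY]) simp
  \<comment> \<open>Outside this event the noise cannot move the limit from \<open>L\<close> to \<open>0\<close>.\<close>
  define bad where "bad = {\<omega> \<in> space M. 1 \<le> ennreal (c / real L) * T \<omega>}"
  have bad: "bad \<in> events" unfolding bad_def by measurable
  have nc: "0 \<le> noise_const \<rho>"
  proof -
    have "sqrt (1 + m) < \<rho>" using \<rho> noise_rate by (intro real_less_lsqrt) auto
    then show ?thesis using \<rho> law_var_nonneg by (simp add: noise_const_def)
  qed
  have "emeasure M bad \<le> ennreal (c / real L) * (\<integral>\<^sup>+\<omega>. T \<omega> * indicator (space M) \<omega> \<partial>M)"
    unfolding bad_def by (rule nn_integral_Markov_inequality) auto
  also have "\<dots> \<le> ennreal (c / real L) * ennreal (noise_const \<rho> * sqrt (real L))"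
    using ET by (intro mult_left_mono) (auto cong: nn_integral_cong)
  also have "\<dots> = ennreal (c * noise_const \<rho> / sqrt (real L))"
    using c L nc by (simp add: ennreal_mult[symmetric] real_div_sqrt field_simps)
  finally have prob_bad: "prob bad \<le> c * noise_const \<rho> / sqrt (real L)"
    using c L nc by (simp add: emeasure_eq_measure)
  have pos: "0 < W \<omega>"
    if W: "(\<lambda>n. real (Z n \<omega>) / mean_pop_size a m n) \<longlonglongrightarrow> W \<omega>" and good: "\<omega> \<in> space M" "\<omega> \<notin> bad" "L \<le> X k 0 \<omega>" for \<omega>
  proof -
    define e where "e i = (\<Sum>j=1..Y (i - 1) \<omega>. real (R j (k + i) \<omega>) - m)" for i
    define s where "s i = \<bar>e (Suc i)\<bar> / S.\<mu> (Suc i)" for i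
    define t where "t i = \<bar>e (Suc i)\<bar> / \<rho> ^ Suc i" for i
    have lin: "linear_aging (\<lambda>i. a (k + i)) m (\<lambda>i b. real (y i b \<omega>)) e"
      using linear_aging_bp[of "\<lambda>i. a (k + i)" m ?z "\<lambda>j i. R j (k + i) \<omega>" "\<lambda>_. 0"]
      by (simp add: y_def Y_def e_def[abs_def])
    have size: "pop_size (\<lambda>i. a (k + i)) (\<lambda>i b. real (y i b \<omega>)) i = real (Y i \<omega>)" for i
      by (simp add: y_def Y_def pop_size_real_aging_bp)
    have T_eq: "T \<omega> = (\<Sum>i. ennreal (t i))"
      by (simp add: T_def t_def e_def noise_def)
    have t0: "0 \<le> t i" and s0: "0 \<le> s i" for i
      using \<rho> S.mean_pop_size_pos[of "Suc i"] by (simp_all add: t_def s_def less_imp_le)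
    have st: "s i \<le> t i" for i
      unfolding s_def t_def using S.mean_pop_size_ge[of "Suc i"] \<rho> S.mean_pop_size_pos[of "Suc i"]
      by (intro divide_left_mono) auto
    have less: "ennreal (c / real L) * T \<omega> < 1"
      using good by (simp add: bad_def not_le)
    have "T \<omega> \<noteq> top"
      using less c L by (auto simp: ennreal_mult_top)
    then have t: "summable t"
      unfolding T_eq by (intro summable_suminf_not_top t0)
    then have s: "summable s"
      using st s0 by (intro summable_comparison_test'[OF t, of 0]) auto
    have "ennreal (c / real L * suminf t) < ennreal 1"
      using less t c L t0 unfolding T_eq
      by (simp add: suminf_ennreal2 ennreal_mult[symmetric] suminf_nonneg)
    moreover have "0 \<le> c / real L * suminf t"
      using c t t0 by (intro mult_nonneg_nonneg suminf_nonneg) auto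
    ultimately have "c / real L * suminf t < 1"
      by (simp only: ennreal_less_iff)
    then have ct: "c * suminf t < real L"
      using L by (simp add: field_simps)
    note conv = S.ratio_convergent[OF lin s[unfolded s_def], unfolded size]
    have "\<bar>lim (\<lambda>i. real (Y i \<omega>) / S.\<mu> i) - real (y 0 0 \<omega>)\<bar> \<le> c * suminf s"
      unfolding c_def s_def by (rule conv(2)) (simp add: y_def)
    also have "c * suminf s \<le> c * suminf t"
      using c s t st by (intro mult_left_mono suminf_le) auto
    finally have lim_pos: "0 < lim (\<lambda>i. real (Y i \<omega>) / S.\<mu> i)"
      using ct by (simp add: y_def)
    show ?thesis
    proof (rule limit_pos_of_growing_subpopulation[OF k _ lim_pos _ W])
      show "(\<lambda>i. real (Y i \<omega>) / S.\<mu> i) \<longlonglongrightarrow> lim (\<lambda>i. real (Y i \<omega>) / S.\<mu> i)"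
        using conv(1) by (simp add: convergent_LIMSEQ_iff)
      have "y i b \<omega> \<le> X (k + i) b \<omega>" for i b
        unfolding y_def X_def using good(3)
        by (intro aging_bp_dominates_subpopulation) (auto simp: X_def)
      then show "real (Y i \<omega>) \<le> real (Z (k + i) \<omega>)" for i
        by (auto simp: y_def X_def Y_def Z_def aging_bp_size_def intro!: sum_mono simp flip: of_nat_sum)
    qed
  qed
  have "prob {\<omega> \<in> space M. \<not> 0 < W \<omega>} \<le> prob ({\<omega> \<in> space M. X k 0 \<omega> < L} \<union> bad)"
  proof (rule finite_measure_mono_AE)
    show "AE \<omega> in M. \<omega> \<in> {\<omega> \<in> space M. \<not> 0 < W \<omega>} \<longrightarrow> \<omega> \<in> {\<omega> \<in> space M. X k 0 \<omega> < L} \<union> bad"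
      using AE_tendsto_W
    proof eventually_elim
      case (elim \<omega>)
      then show ?case using pos[OF elim] by (cases "X k 0 \<omega> < L"; cases "\<omega> \<in> bad") auto
    qed
  qed (use bad in measurable)
  also have "\<dots> \<le> prob {\<omega> \<in> space M. X k 0 \<omega> < L} + prob bad"
    using bad by (intro measure_Un_le) measurable
  finally show ?thesis using prob_bad unfolding c_def by linarith
qed

lemma AE_W_pos: "AE \<omega> in M. 0 < W \<omega>"
proof -
  have "prob {\<omega> \<in> space M. \<not> 0 < W \<omega>} \<le> 0"
  proof (rule field_le_epsilon)
    fix \<epsilon> :: real assume \<epsilon>: "0 < \<epsilon>"
    let ?C = "2 / (1 - 1 / \<rho>) * noise_const \<rho>"
    have "(\<lambda>L. ?C / sqrt (real L)) \<longlonglongrightarrow> 0"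
      by real_asymp
    then have "\<forall>\<^sub>F L in sequentially. ?C / sqrt (real L) < \<epsilon> / 2"
      using \<epsilon> by (intro order_tendstoD(2)) auto
    from eventually_conj[OF this eventually_gt_at_top[of 0]]
    obtain L where L: "?C / sqrt (real L) < \<epsilon> / 2" "0 < L"
      by (auto simp: eventually_sequentially)
    obtain k0 where k0: "\<And>k. k0 \<le> k \<Longrightarrow> prob {\<omega> \<in> space M. X k 0 \<omega> < L} < \<epsilon> / 2"
      using newborns_unbounded_in_probability[of "\<epsilon> / 2" L] \<epsilon> by auto
    obtain k1 where k1: "\<And>k. k1 \<le> k \<Longrightarrow> slow_from k"
      using eventually_slow by blast
    show "prob {\<omega> \<in> space M. \<not> 0 < W \<omega>} \<le> 0 + \<epsilon>"
      using prob_not_surviving_le[OF k1[of "max k0 k1"] L(2)] k0[of "max k0 k1"] L(1) by simp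
  qed
  then have "prob {\<omega> \<in> space M. \<not> 0 < W \<omega>} = 0"
    using measure_nonneg[of M] by (intro antisym)
  then show ?thesis
    by (subst AE_iff_measurable[OF _ refl]) (auto simp: emeasure_eq_measure)
qed

end

section \<open>Convergence of the normalised size and of the age profile\<close>

theorem theorem3:
  fixes M :: "'a measure"
    and amax :: "nat \<Rightarrow> nat"
    and Z0 :: "nat \<Rightarrow> 'a \<Rightarrow> nat"
    and R_law :: "nat pmf"
    and R :: "nat \<Rightarrow> nat \<Rightarrow> 'a \<Rightarrow> nat"
    and I :: "nat \<Rightarrow> 'a \<Rightarrow> nat"
    and N :: "'b measure"
    and Imin :: "'b \<Rightarrow> real"
    and m :: real
    and Za :: "nat \<Rightarrow> nat \<Rightarrow> 'a \<Rightarrow> nat"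
    and Z :: "nat \<Rightarrow> 'a \<Rightarrow> nat"
  assumes "prob_space M"
    and amax_mono: "\<And>n. amax n \<le> amax (Suc n)"
    and amax_step: "\<And>n. amax (Suc n) \<le> amax n + 1"
    and amax_lim: "filterlim amax at_top sequentially"
    and Z0_meas: "\<And>a. Z0 a \<in> measurable M (count_space UNIV)"
    and Z0_bounded: "\<exists>B. AE \<omega> in M. \<forall>a. Z0 a \<omega> \<le> B"
    and Z0_age: "AE \<omega> in M. \<forall>a>amax 0. Z0 a \<omega> = 0"
    and R_meas: "\<And>j n. j \<ge> 1 \<Longrightarrow> n \<ge> 1 \<Longrightarrow> R j n \<in> measurable M (count_space UNIV)"
    and R_distr: "\<And>j n. j \<ge> 1 \<Longrightarrow> n \<ge> 1 \<Longrightarrow>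
                    distr M (count_space UNIV) (R j n) = measure_pmf R_law"
    and I_meas: "\<And>n. n \<ge> 1 \<Longrightarrow> I n \<in> measurable M (count_space UNIV)"
    and indep: "prob_space.indep_sources M Z0 R I"
    and m_def: "m = measure_pmf.expectation R_law real"
    and m_pos: "m > 0"
    and R_square: "integrable (measure_pmf R_law) (\<lambda>k. (real k)\<^sup>2)"
    and I_growth: "limsup (\<lambda>n. ln_ennreal (\<integral>\<^sup>+\<omega>. of_nat (I n \<omega>) \<partial>M) / ereal (real n))
                     < ereal (ln (1 + m))"
    and "prob_space N"
    and Imin_meas: "Imin \<in> borel_measurable N"
    and Imin_nonneg: "AE \<eta> in N. Imin \<eta> \<ge> 0"
    and Imin_pos: "measure N {\<eta> \<in> space N. Imin \<eta> > 0} > 0"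
    and I_dominates: "\<And>n x. n \<ge> 1 \<Longrightarrow> x \<ge> 0 \<Longrightarrow>
                        measure M {\<omega> \<in> space M. real (I n \<omega>) \<ge> x}
                          \<ge> measure N {\<eta> \<in> space N. Imin \<eta> \<ge> x}"
    and Za_def: "\<And>n a \<omega>. Za n a \<omega> =
                   aging_bp amax (\<lambda>b. Z0 b \<omega>) (\<lambda>j k. R j k \<omega>) (\<lambda>k. I k \<omega>) n a"
    and Z_def: "\<And>n \<omega>. Z n \<omega> =
                   aging_bp_size amax (\<lambda>b. Z0 b \<omega>) (\<lambda>j k. R j k \<omega>) (\<lambda>k. I k \<omega>) n"
  shows "(\<exists>W \<in> borel_measurable M. AE \<omega> in M. W \<omega> > (0::real) \<and>
            (\<lambda>n. real (Z n \<omega>) / mean_size M amax R n) \<longlonglongrightarrow> W \<omega>)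
       \<and> (\<forall>a. AE \<omega> in M. (\<lambda>n. real (Za n a \<omega>) / real (Z n \<omega>)) \<longlonglongrightarrow> m / (m + 1) ^ (a + 1))"
proof -
  interpret P: prob_space M by fact
  interpret N: prob_space N by fact
  obtain r n0 where r: "0 < r" "r < 1 + m" "\<And>n. n0 \<le> n \<Longrightarrow> (\<integral>\<^sup>+\<omega>. of_nat (I n \<omega>) \<partial>M) \<le> ennreal (r ^ n)"
    using eventually_le_power_if_limsup_log_less[OF I_growth] m_pos by auto
  have sqrt_less: "1 < sqrt (1 + m)" "sqrt (1 + m) < 1 + m"
    using m_pos mult_strict_left_mono[of 1 "sqrt (1 + m)" "sqrt (1 + m)"] by auto
  have "max r (sqrt (1 + m)) < 1 + m" using r(2) sqrt_less(2) by simp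
  then obtain \<rho> where "r < \<rho>" "sqrt (1 + m) < \<rho>" "\<rho> < 1 + m"
    using dense by (metis max_less_iff_conj)
  then have \<rho>: "1 < \<rho>" "\<rho> < 1 + m" "r < \<rho>" "sqrt (1 + m) < \<rho>"
    using sqrt_less(1) by linarith+
  have \<rho>2: "1 + m < \<rho>\<^sup>2"
    using power_strict_mono[OF \<rho>(4), of 2] m_pos by simp
  obtain x where x: "0 < x" "0 < measure N {\<eta> \<in> space N. Imin \<eta> \<ge> x}"
    using N.uniformly_positive_tail[OF Imin_meas Imin_pos] by blast
  have I_prob: "measure N {\<eta> \<in> space N. Imin \<eta> \<ge> x} \<le> P.prob {\<omega> \<in> space M. 1 \<le> I n \<omega>}" if n: "1 \<le> n" for n
  proof -
    have "measure N {\<eta> \<in> space N. Imin \<eta> \<ge> x} \<le> P.prob {\<omega> \<in> space M. real (I n \<omega>) \<ge> x}"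
      using I_dominates[OF n, of x] x(1) by simp
    also have "\<dots> \<le> P.prob {\<omega> \<in> space M. 1 \<le> I n \<omega>}"
    proof (rule P.finite_measure_mono)
      show "{\<omega> \<in> space M. real (I n \<omega>) \<ge> x} \<subseteq> {\<omega> \<in> space M. 1 \<le> I n \<omega>}"
        using x(1) by (auto simp: Suc_le_eq intro: gr0I)
      show "{\<omega> \<in> space M. 1 \<le> I n \<omega>} \<in> P.events"
        using I_meas[OF n] by measurable
    qed
    finally show ?thesis .
  qed
  interpret B: immigration_process M Z0 R I R_law m amax \<rho> r "measure N {\<eta> \<in> space N. Imin \<eta> \<ge> x}" n0
    using assms r \<rho> \<rho>2 x(2) I_prob by unfold_locales auto
  have Z_eq: "Z n \<omega> = B.Z n \<omega>" and Za_eq: "Za n b \<omega> = B.X n b \<omega>" for n b \<omega>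
    by (simp_all add: Z_def Za_def B.Z_def B.X_def)
  note mean_eq = B.mean_size_eq_mean_pop_size
  have "AE \<omega> in M. B.W \<omega> > 0 \<and> (\<lambda>n. real (Z n \<omega>) / mean_size M amax R n) \<longlonglongrightarrow> B.W \<omega>"
    using B.AE_tendsto_W B.AE_W_pos by eventually_elim (simp add: Z_eq mean_eq)
  moreover have "AE \<omega> in M. (\<lambda>n. real (Za n b \<omega>) / real (Z n \<omega>)) \<longlonglongrightarrow> m / (m + 1) ^ (b + 1)" for b
    using B.AE_tendsto_W B.AE_W_pos B.AE_perturbation_summable
  proof eventually_elim
    case (elim \<omega>)
    then show ?case
      using B.age_profile[OF B.X_linear elim(3), unfolded B.X_pop_size, OF elim(1)]
      by (simp add: Z_eq Za_eq)
  qed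
  ultimately show ?thesis using B.W_meas by blast
qed

end
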